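(* Let $\mathcal{A}$ be a Banach algebra such that $\mathrm{rad}(\mathcal{A})=\mathrm{rann}(\mathcal{A})$ and $\mathcal{A}/\mathrm{rad}(\mathcal{A})$ is commutative, and suppose $\mathcal{A}$ has a right identity. Let $(\delta,d)$ be a generalized derivation of $\mathcal{A}$. Then the following are equivalent: (i) $[[\delta(a),a],\delta(a)]\in Z(\mathcal{A})$ for all $a\in\mathcal{A}$; (ii) $d\perp\delta$; (iii) $(\delta^2,d^2)$ is a generalized derivation of $\mathcal{A}$.
   Context: $\mathrm{rad}(\mathcal{A})$ is the Jacobson radical and $\mathrm{rann}(\mathcal{A})=\{c\in\mathcal{A}: ac=0\ \forall a\in\mathcal{A}\}$. A derivation is a linear map $d$ with $d(ab)=d(a)b+ad(b)$; a generalized derivation $(\delta,d)$ consists of a derivation $d$ and a linear $\delta$ with $\delta(ab)=a\delta(b)+d(a)b$ for all $a,b$. $Z(\mathcal{A})$ is the center, $[x,y]=xy-yx$. Maps $T,S:\mathcal{A}\to\mathcal{A}$ are orthogonal, $T\perp S$, if $T(a)cS(b)=S(b)cT(a)=0$ for all $a,b,c\in\mathcal{A}$. *)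

theory Defs
  imports "HOL-Analysis.Analysis"
begin

text \<open>A complex Banach algebra is encoded as a real Banach algebra
  (class real_normed_algebra + banach, not necessarily unital) together with
  an operator J (multiplication by the imaginary unit) making it a complex
  normed algebra: (a + b i) x = a x + b (J x).\<close>

definition complex_structure :: "('a::real_normed_algebra \<Rightarrow> 'a) \<Rightarrow> bool" where
  "complex_structure J \<longleftrightarrow> linear J \<and> (\<forall>x. J (J x) = - x)
     \<and> (\<forall>x y. J (x * y) = J x * y \<and> J (x * y) = x * J y)
     \<and> (\<forall>(t::real) x. norm (cos t *\<^sub>R x + sin t *\<^sub>R J x) = norm x)"

definition clinear :: "('a::real_normed_algebra \<Rightarrow> 'a) \<Rightarrow> ('a \<Rightarrow> 'a) \<Rightarrow> bool" where
  "clinear J T \<longleftrightarrow> linear T \<and> (\<forall>x. T (J x) = J (T x))"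

text \<open>Jacobson radical of a (possibly non-unital) ring, via quasi-regularity:
  a is in rad iff b*a is left quasi-invertible for all b.\<close>
definition left_quasi_invertible :: "'a::ring \<Rightarrow> bool" where
  "left_quasi_invertible a \<longleftrightarrow> (\<exists>c. c + a - c * a = 0)"

definition jrad :: "'a::ring set" where
  "jrad = {a. \<forall>b. left_quasi_invertible (b * a)}"

definition rann :: "'a::ring set" where
  "rann = {c. \<forall>a. a * c = 0}"

definition center :: "'a::ring set" where
  "center = {z. \<forall>x. z * x = x * z}"

definition comm :: "'a::ring \<Rightarrow> 'a \<Rightarrow> 'a" where
  "comm x y = x * y - y * x"

definition is_derivation :: "('a::real_normed_algebra \<Rightarrow> 'a) \<Rightarrow> ('a \<Rightarrow> 'a) \<Rightarrow> bool" where
  "is_derivation J d \<longleftrightarrow> clinear J d \<and> (\<forall>a b. d (a * b) = d a * b + a * d b)"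

definition is_gen_derivation :: "('a::real_normed_algebra \<Rightarrow> 'a) \<Rightarrow> ('a \<Rightarrow> 'a) \<Rightarrow> ('a \<Rightarrow> 'a) \<Rightarrow> bool" where
  "is_gen_derivation J \<delta> d \<longleftrightarrow> is_derivation J d \<and> clinear J \<delta>
     \<and> (\<forall>a b. \<delta> (a * b) = a * \<delta> b + d a * b)"

definition orthogonal_maps :: "('a::ring \<Rightarrow> 'a) \<Rightarrow> ('a \<Rightarrow> 'a) \<Rightarrow> bool" where
  "orthogonal_maps T S \<longleftrightarrow> (\<forall>a b c. T a * c * S b = 0 \<and> S b * c * T a = 0)"

end

theory Submission
  imports Defs
begin

text \<open>
  Let \<open>e\<close> be a right identity.  The corner \<open>B = e A\<close> is a closed commutative subalgebra with
  identity \<open>e\<close>, isomorphic to the semisimple quotient of \<open>A\<close> by its radical, and \<open>D y = e * d y\<close>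
  restricts to a derivation of \<open>B\<close>.  It vanishes (Johnson, Singer--Wermer): if its separating space
  \<open>S\<close> were nonzero, a gliding hump argument would give a minimal closed ideal of the form \<open>closure (c S)\<close>,
  which by Gelfand--Mazur consists of the complex multiples of an idempotent, where \<open>D\<close> is zero;
  hence \<open>D\<close> is bounded, and by Kleinecke--Shirokov its values are quasinilpotent.  So \<open>d\<close> maps into
  the right annihilator, and with \<open>f = \<delta> e\<close> each of the three conditions says that
  \<open>d a * f = 0\<close> for all \<open>a\<close>.
\<close>

section \<open>The separating space of a linear map\<close>

text \<open>No norm bound on \<open>d\<close> is assumed, whereas Kleinecke--Shirokov needs one;
  establishing continuity is therefore most of the work. The corner takes the place of the quotient:
  \<open>a - e * a\<close> is annihilated from the left, so the algebra is the direct sum of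
  \<open>e A\<close> and the right annihilator, and \<open>e A\<close> inherits norm, completeness
  and complex scalars, with \<open>J e\<close> as imaginary unit. The three conditions meet because
  \<open>\<delta> a = a * f + d a\<close> and every product \<open>x * d y\<close> vanishes: the
  double commutator shrinks to \<open>d a * (a * (a * f))\<close>, and the defect of
  \<open>\<delta> \<circ> \<delta>\<close> to \<open>2 *\<^sub>R (d a * (b * f))\<close>.\<close>

definition separating_space :: "('a::real_normed_vector \<Rightarrow> 'b::real_normed_vector) \<Rightarrow> 'b set" where
  "separating_space D = {v. \<exists>y. y \<longlonglongrightarrow> 0 \<and> (\<lambda>n. D (y n)) \<longlonglongrightarrow> v}"

lemma separating_spaceI:
  "y \<longlonglongrightarrow> 0 \<Longrightarrow> (\<lambda>n. D (y n)) \<longlonglongrightarrow> v \<Longrightarrow> v \<in> separating_space D"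
  by (auto simp: separating_space_def)

lemma separating_spaceE:
  assumes "v \<in> separating_space D"
  obtains y where "y \<longlonglongrightarrow> 0" "(\<lambda>n. D (y n)) \<longlonglongrightarrow> v"
  using assms by (auto simp: separating_space_def)

lemma subspace_separating_space:
  assumes "linear D"
  shows "subspace (separating_space D)"
  unfolding subspace_def
proof (intro conjI ballI allI)
  show "0 \<in> separating_space D"
    by (rule separating_spaceI[of "\<lambda>_. 0"]) (auto simp: linear_0[OF assms])
next
  fix x y assume "x \<in> separating_space D" "y \<in> separating_space D"
  then obtain u v where "u \<longlonglongrightarrow> 0" "(\<lambda>n. D (u n)) \<longlonglongrightarrow> x" "v \<longlonglongrightarrow> 0" "(\<lambda>n. D (v n)) \<longlonglongrightarrow> y"
    by (auto elim!: separating_spaceE)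
  then show "x + y \<in> separating_space D"
    by (intro separating_spaceI[of "\<lambda>n. u n + v n"])
       (auto intro!: tendsto_add tendsto_add_zero simp: linear_add[OF assms])
next
  fix c :: real and x assume "x \<in> separating_space D"
  then obtain u where u: "u \<longlonglongrightarrow> 0" "(\<lambda>n. D (u n)) \<longlonglongrightarrow> x"
    by (auto elim!: separating_spaceE)
  then show "c *\<^sub>R x \<in> separating_space D"
    using tendsto_scaleR[OF tendsto_const u(1), of c]
    by (intro separating_spaceI[of "\<lambda>n. c *\<^sub>R u n"])
       (auto intro!: tendsto_scaleR simp: linear_scale[OF assms])
qed

text \<open>The open mapping argument behind the closed graph theorem. By Baire some
  \<open>V k\<close> contains a ball, so points near 0 are approximated by \<open>u\<close> with
  \<open>D u\<close> bounded; repeating this at halved scales splits \<open>D y\<close> into a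
  convergent series and the limit of \<open>D (f n)\<close> with \<open>f n\<close> tending to
  0.\<close>

lemma linear_bounded_modulo_separating_space:
  fixes D :: "'a::banach \<Rightarrow> 'b::banach"
  assumes lin: "linear D"
  shows "\<exists>C. \<forall>y. \<exists>s\<in>separating_space D. norm (D y - s) \<le> C * norm y"
proof -
  define V where "V k = closure {y. norm (D y) \<le> real k}" for k :: nat
  have "\<exists>k. interior (V k) \<noteq> {}"
  proof (rule ccontr)
    assume "\<not> ?thesis"
    then have "euclidean interior_of \<Union>(range V) = {}"
      by (intro Baire_category_alt) (auto simp: V_def completely_metrizable_space_euclidean)
    moreover have "y \<in> \<Union>(range V)" for y
    proof -
      have "norm (D y) \<le> real (nat \<lceil>norm (D y)\<rceil>)"
        by linarith
      then have "y \<in> V (nat \<lceil>norm (D y)\<rceil>)"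
        unfolding V_def using closure_subset by fastforce
      then show ?thesis by blast
    qed
    then have "\<Union>(range V) = UNIV" by blast
    ultimately show False by simp
  qed
  then obtain k y0 where "y0 \<in> interior (V k)" by blast
  then obtain r where r: "r > 0" "ball y0 r \<subseteq> V k"
    by (auto simp: mem_interior)
  define K where "K = 2 * real k"
  have near: "\<exists>u. norm (y - u) < \<epsilon> \<and> norm (D u) \<le> K" if "norm y < r" "\<epsilon> > 0" for y \<epsilon>
  proof -
    have "y0 + y \<in> V k" "y0 \<in> V k"
      using r that(1) by (auto simp: subset_iff dist_norm)
    then obtain u v where u: "norm (D u) \<le> k" "dist u (y0 + y) < \<epsilon>/2"
      and v: "norm (D v) \<le> k" "dist v y0 < \<epsilon>/2"
      unfolding V_def closure_approachable using \<open>\<epsilon> > 0\<close>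
      by (metis half_gt_zero mem_Collect_eq)
    have "y - (u - v) = (v - y0) - (u - (y0 + y))" by simp
    then have "norm (y - (u - v)) \<le> norm (v - y0) + norm (u - (y0 + y))"
      by (metis norm_triangle_ineq4)
    then have "norm (y - (u - v)) < \<epsilon>"
      using u v by (simp add: dist_norm)
    moreover have "norm (D (u - v)) \<le> K"
      using norm_triangle_ineq4[of "D u" "D v"] u v by (simp add: K_def linear_diff[OF lin])
    ultimately show ?thesis by blast
  qed
  have step: "\<exists>u. norm (y - u) < r / 2 ^ Suc n \<and> norm (D u) \<le> K / 2 ^ n"
    if "norm y < r / 2 ^ n" for y n
  proof -
    have "norm ((2::real) ^ n *\<^sub>R y) < r"
      using that by (simp add: field_simps)
    from near[OF this, of "r/2"] r obtain u where
      u: "norm (2 ^ n *\<^sub>R y - u) < r/2" "norm (D u) \<le> K" by auto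
    define u' where "u' = inverse (2 ^ n :: real) *\<^sub>R u"
    have "2 ^ n *\<^sub>R y - u = (2::real) ^ n *\<^sub>R (y - u')"
      by (simp add: u'_def algebra_simps)
    then have "norm (2 ^ n *\<^sub>R y - u) = 2 ^ n * norm (y - u')"
      by (simp only: norm_scaleR) simp
    then have "norm (y - u') < r / 2 ^ Suc n"
      using u(1) by (simp add: field_simps)
    moreover have "norm (D u') \<le> K / 2 ^ n"
      using u(2) by (simp add: u'_def linear_scale[OF lin] field_simps)
    ultimately show ?thesis by blast
  qed
  have small: "\<exists>s\<in>separating_space D. norm (D y - s) \<le> 2 * K" if "norm y < r" for y
  proof -
    have "\<exists>f. \<forall>n. ((n = 0 \<longrightarrow> f n = y) \<and> norm (f n) < r / 2 ^ n)
        \<and> norm (D (f n - f (Suc n))) \<le> K / 2 ^ n"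
    proof (rule dependent_nat_choice)
      show "\<exists>x. (0 = (0::nat) \<longrightarrow> x = y) \<and> norm x < r / 2 ^ 0" using that by auto
    next
      fix x and n :: nat
      assume "(n = 0 \<longrightarrow> x = y) \<and> norm x < r / 2 ^ n"
      with step obtain u where "norm (x - u) < r / 2 ^ Suc n" "norm (D u) \<le> K / 2 ^ n" by blast
      then show "\<exists>z. ((Suc n = 0 \<longrightarrow> z = y) \<and> norm z < r / 2 ^ Suc n) \<and> norm (D (x - z)) \<le> K / 2 ^ n"
        by (intro exI[of _ "x - u"]) auto
    qed
    then obtain f where f0: "f 0 = y" and fn: "\<And>n. norm (f n) < r / 2 ^ n"
      and fD: "\<And>n. norm (D (f n - f (Suc n))) \<le> K / 2 ^ n" by blast
    define g where "g j = D (f j - f (Suc j))" for j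
    have geo: "(\<lambda>n. K / 2 ^ n) sums (2 * K)"
    proof -
      have "K / 2 ^ n = K * (1/2) ^ n" for n by (simp add: power_one_over)
      then show ?thesis using sums_mult[OF geometric_sums[of "1/2::real"], of K] by (simp add: mult.commute)
    qed
    have "summable (\<lambda>n. norm (g n))"
      by (rule summable_comparison_test[OF _ sums_summable[OF geo]]) (use fD in \<open>auto simp: g_def\<close>)
    then have sg: "summable g" and ng: "norm (suminf g) \<le> (\<Sum>n. norm (g n))"
      by (auto intro: summable_norm_cancel summable_norm)
    have "(\<Sum>n. norm (g n)) \<le> (\<Sum>n. K / 2 ^ n)"
      by (rule suminf_le) (use fD \<open>summable (\<lambda>n. norm (g n))\<close> sums_summable[OF geo] in \<open>auto simp: g_def\<close>)
    then have ng: "norm (suminf g) \<le> 2 * K"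
      using ng sums_unique[OF geo] by simp
    have part: "(\<Sum>j<n. g j) = D y - D (f n)" for n
      by (induction n) (auto simp: f0 g_def linear_diff[OF lin])
    have "f \<longlonglongrightarrow> 0"
    proof (rule Lim_null_comparison)
      show "\<forall>\<^sub>F n in sequentially. norm (f n) \<le> r * (1/2) ^ n"
        using fn by (auto intro!: always_eventually less_imp_le simp: power_one_over)
      show "(\<lambda>n. r * (1/2) ^ n) \<longlonglongrightarrow> 0"
        by (intro tendsto_mult_right_zero LIMSEQ_power_zero) auto
    qed
    moreover have "(\<lambda>n. D (f n)) \<longlonglongrightarrow> D y - suminf g"
    proof -
      have "(\<lambda>n. D y - (\<Sum>j<n. g j)) \<longlonglongrightarrow> D y - suminf g"
        by (intro tendsto_diff tendsto_const summable_LIMSEQ sg)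
      then show ?thesis by (simp add: part)
    qed
    ultimately have "D y - suminf g \<in> separating_space D"
      by (rule separating_spaceI)
    then show ?thesis using ng by (intro bexI[of _ "D y - suminf g"]) auto
  qed
  have sub: "subspace (separating_space D)" by (rule subspace_separating_space[OF lin])
  show ?thesis
  proof (intro exI allI)
    fix y
    show "\<exists>s\<in>separating_space D. norm (D y - s) \<le> (4 * K / r) * norm y"
    proof (cases "y = 0")
      case True
      then show ?thesis using subspace_0[OF sub] by (intro bexI[of _ 0]) (auto simp: linear_0[OF lin])
    next
      case False
      define c where "c = r / (2 * norm y)"
      have c: "c > 0" using r False by (simp add: c_def)
      have "norm (c *\<^sub>R y) < r" using r False by (simp add: c_def)
      from small[OF this] obtain s where s: "s \<in> separating_space D" "norm (D (c *\<^sub>R y) - s) \<le> 2 * K" by blast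
      have "D y - inverse c *\<^sub>R s = inverse c *\<^sub>R (D (c *\<^sub>R y) - s)"
        using c by (simp add: linear_scale[OF lin] algebra_simps)
      then have "norm (D y - inverse c *\<^sub>R s) \<le> inverse c * (2 * K)"
        using s(2) c by simp
      also have "\<dots> = (4 * K / r) * norm y"
        using r False by (simp add: c_def field_simps)
      finally show ?thesis
        using subspace_scale[OF sub s(1), of "inverse c"] by blast
    qed
  qed
qed

section \<open>Neumann series and distances to subspaces\<close>

lemma quasi_inverse_exists:
  fixes y :: "'a::{real_normed_algebra, banach}"
  assumes "norm y < 1"
  shows "\<exists>s. s = y + y * s"
proof -
  \<comment> \<open>The fixed point is the series y + y^2 + ..., obtained without a unit in the
    type.\<close>
  have "\<exists>!s. y + y * s = s"
  proof (rule banach_fix_type[of "norm y"])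
    show "\<forall>u v. dist (y + y * u) (y + y * v) \<le> norm y * dist u v"
      by (metis add_diff_cancel_left dist_norm norm_mult_ineq right_diff_distrib)
  qed (use assms in auto)
  then show ?thesis by metis
qed

lemma infdist_less_obtain:
  assumes "W \<noteq> {}" "infdist u W < r"
  obtains a where "a \<in> W" "dist u a < r"
  using assms cInf_lessD[of "dist u ` W" r] by (auto simp: infdist_notempty)

text \<open>For a subspace \<open>W\<close>, \<open>infdist\<close> is the seminorm of the quotient
  by \<open>W\<close>; it lets later arguments work modulo a subspace without a quotient
  type.\<close>

lemma infdist_subspace_add:
  fixes W :: "'a::real_normed_vector set"
  assumes "subspace W"
  shows "infdist (u + v) W \<le> infdist u W + infdist v W"
proof (rule field_le_epsilon)
  fix \<epsilon> :: real assume "\<epsilon> > 0"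
  have "W \<noteq> {}" using subspace_0[OF assms] by blast
  obtain a where a: "a \<in> W" "dist u a < infdist u W + \<epsilon>/2"
    using infdist_less_obtain[OF \<open>W \<noteq> {}\<close>, of u "infdist u W + \<epsilon>/2"] \<open>\<epsilon> > 0\<close> by auto
  obtain b where b: "b \<in> W" "dist v b < infdist v W + \<epsilon>/2"
    using infdist_less_obtain[OF \<open>W \<noteq> {}\<close>, of v "infdist v W + \<epsilon>/2"] \<open>\<epsilon> > 0\<close> by auto
  have "infdist (u + v) W \<le> dist (u + v) (a + b)"
    using a b by (intro infdist_le subspace_add[OF assms])
  also have "\<dots> \<le> dist u a + dist v b" by (rule dist_triangle_add)
  finally show "infdist (u + v) W \<le> infdist u W + infdist v W + \<epsilon>"
    using a b by linarith
qed

lemma infdist_subspace_scaleR_ge: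
  fixes W :: "'a::real_normed_vector set"
  assumes "subspace W" "t > 0"
  shows "t * infdist v W \<le> infdist (t *\<^sub>R v) W"
proof -
  have "W \<noteq> {}" using subspace_0[OF assms(1)] by blast
  have "t * infdist v W \<le> dist (t *\<^sub>R v) w" if "w \<in> W" for w
  proof -
    have "t *\<^sub>R v - w = t *\<^sub>R (v - inverse t *\<^sub>R w)" using assms(2) by (simp add: algebra_simps)
    then have "dist (t *\<^sub>R v) w = t * dist v (inverse t *\<^sub>R w)"
      using assms(2) unfolding dist_norm by (simp only: norm_scaleR)
    moreover have "infdist v W \<le> dist v (inverse t *\<^sub>R w)"
      by (intro infdist_le subspace_scale[OF assms(1)] that)
    ultimately show ?thesis using assms(2) by simp
  qed
  then show ?thesis
    unfolding infdist_notempty[OF \<open>W \<noteq> {}\<close>, of "t *\<^sub>R v"] by (intro cINF_greatest[OF \<open>W \<noteq> {}\<close>])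
qed

lemma infdist_subspace_le_norm:
  fixes W :: "'a::real_normed_vector set"
  shows "subspace W \<Longrightarrow> infdist v W \<le> norm v"
  using infdist_le[OF subspace_0, of W v] by simp

section \<open>The Gelfand--Mazur theorem\<close>

lemma cis_root_unity_power:
  assumes "N > 0"
  shows "cis (2 * pi * real k / real N) ^ N = 1"
proof -
  have "cis (2 * pi * real k / real N) ^ N = cis (2 * pi * real k)"
    using assms by (simp add: Complex.DeMoivre)
  then show ?thesis by simp
qed

text \<open>The summands form a geometric progression whose ratio is an \<open>N\<close>-th root of
  unity other than 1. Averaging over the points thus removes all degrees strictly between 0 and
  \<open>N\<close>.\<close>

lemma sum_power_scaled_roots_unity:
  fixes r :: complex
  assumes "0 < n" "n < N"
  shows "(\<Sum>k<N. (cis (2 * pi * real k / real N) * r) ^ n) = 0"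
proof -
  define \<omega> where "\<omega> = cis (2 * pi * real n / real N)"
  have "inj_on (\<lambda>k. cis (2 * pi * real k / real N)) {..<N}"
    using Complex.bij_betw_roots_unity[of N] assms by (auto simp: bij_betw_def)
  then have "\<omega> \<noteq> 1"
    using assms inj_onD[of "\<lambda>k. cis (2 * pi * real k / real N)" "{..<N}" n 0] by (auto simp: \<omega>_def)
  have "\<omega> ^ N = 1"
    unfolding \<omega>_def using assms by (intro cis_root_unity_power) auto
  have "(\<Sum>k<N. (cis (2 * pi * real k / real N) * r) ^ n) = (\<Sum>k<N. r ^ n * \<omega> ^ k)"
    by (intro sum.cong refl) (simp add: \<omega>_def power_mult_distrib Complex.DeMoivre mult_ac)
  also have "\<dots> = r ^ n * ((\<omega> ^ N - 1) / (\<omega> - 1))"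
    by (simp add: sum_distrib_left[symmetric] geometric_sum[OF \<open>\<omega> \<noteq> 1\<close>])
  finally show ?thesis using \<open>\<omega> ^ N = 1\<close> by simp
qed

text \<open>If \<open>x\<close> is not a scalar, its resolvent \<open>R\<close> is defined on the whole plane and its norm attains
  a maximum \<open>M\<close>.  Averaging \<open>R\<close> over \<open>N\<close> equally spaced points of a circle with centre \<open>z1\<close> and
  radius below \<open>1 / M\<close> reproduces \<open>R z1\<close> up to an error of order \<open>q\<^sup>N\<close> with \<open>q < 1\<close>, so a maximum at
  \<open>z1\<close> propagates to the whole disc, contradicting the decay of \<open>R\<close> at infinity.\<close>

lemma Gelfand_Mazur_subalgebra:
  fixes F :: "'a::real_normed_algebra set" and p x :: 'a and h :: "complex \<Rightarrow> 'a" and C :: real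
  assumes diffF: "\<And>a b. a \<in> F \<Longrightarrow> b \<in> F \<Longrightarrow> a - b \<in> F"
    and multF: "\<And>a b. a \<in> F \<Longrightarrow> b \<in> F \<Longrightarrow> a * b \<in> F"
    and comF: "\<And>a b. a \<in> F \<Longrightarrow> b \<in> F \<Longrightarrow> a * b = b * a"
    and pF: "p \<in> F" and p_left: "\<And>a. a \<in> F \<Longrightarrow> p * a = a"
    and inverse_F: "\<And>a. a \<in> F \<Longrightarrow> a \<noteq> 0 \<Longrightarrow> \<exists>b\<in>F. a * b = p"
    and hF: "\<And>z. h z \<in> F" and h_add: "\<And>z w. h (z + w) = h z + h w"
    and h_mult: "\<And>z w. h (z * w) = h z * h w" and h_1: "h 1 = p"
    and h_norm: "\<And>z. norm (h z) \<le> C * cmod z"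
    and xF: "x \<in> F"
  shows "\<exists>z. x = h z"
proof (rule ccontr)
  assume "\<nexists>z. x = h z"
  then have nz: "x - h z \<noteq> 0" for z by auto
  have h_0: "h 0 = 0" using h_add[of 0 0] by simp
  have h_diff: "h (z - w) = h z - h w" for z w
    using h_add[of "z - w" w] by simp
  have p_right: "a * p = a" if "a \<in> F" for a
    using comF[OF that pF] p_left[OF that] by simp
  have "p \<noteq> 0" using nz[of 0] p_left[OF xF] h_0 by auto
  have "C > 0" 
  proof -
    have "0 < norm p" using \<open>p \<noteq> 0\<close> by simp
    also have "\<dots> \<le> C" using h_norm[of 1] by (simp add: h_1)
    finally show ?thesis .
  qed
  define R where "R z = (SOME b. b \<in> F \<and> (x - h z) * b = p)" for z
  have "R z \<in> F \<and> (x - h z) * R z = p" for z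
    unfolding R_def by (rule someI_ex) (use inverse_F[OF diffF[OF xF hF] nz] in blast)
  then have RF: "R z \<in> F" and R1: "(x - h z) * R z = p" for z by auto
  have R2: "R z * (x - h z) = p" for z
    using comF[OF RF diffF[OF xF hF]] R1 by simp
  have R_norm_pos: "norm (R z) > 0" for z
    using R1[of z] \<open>p \<noteq> 0\<close> by auto

  have resolvent: "R z' - R z = R z' * (h (z' - z) * R z)" for z z'
  proof -
    have "R z' * (h (z' - z) * R z) = R z' * ((x - h z) - (x - h z')) * R z"
      by (simp add: h_diff mult.assoc)
    also have "\<dots> = R z' * ((x - h z) * R z) - (R z' * (x - h z')) * R z"
      by (simp add: algebra_simps)
    also have "\<dots> = R z' - R z"
      by (simp add: R1 R2 p_left p_right RF)
    finally show ?thesis by simp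
  qed
  have resolvent_norm: "norm (R z' - R z) \<le> norm (R z') * (C * cmod (z' - z) * norm (R z))" for z z'
    unfolding resolvent
    by (intro order_trans[OF norm_mult_ineq] mult_left_mono mult_right_mono h_norm) auto
  \<comment> \<open>The threshold \<open>2 * C * norm x\<close> makes the coefficient of
    \<open>norm (R z)\<close> on the right at most 1/2, so that this term can be absorbed.\<close>
  have decay: "norm (R z) \<le> 2 * C * norm p / cmod z" if "cmod z > 0" "cmod z \<ge> 2 * C * norm x" for z
  proof -
    have "h z * R z = x * R z - p" using R1[of z] by (simp add: algebra_simps)
    moreover have "h (1/z) * h z = p"
      using that(1) h_mult[of "1/z" z] by (simp add: h_1)
    then have "h (1/z) * (h z * R z) = R z"
      by (simp add: mult.assoc[symmetric] p_left RF)
    ultimately have "R z = h (1/z) * (x * R z - p)" by simp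
    then have "norm (R z) \<le> norm (h (1/z)) * norm (x * R z - p)"
      by (metis norm_mult_ineq)
    also have "\<dots> \<le> (C * cmod (1/z)) * (norm x * norm (R z) + norm p)"
      by (intro mult_mono h_norm order_trans[OF norm_triangle_ineq4] add_right_mono norm_mult_ineq)
         (use \<open>C > 0\<close> in auto)
    also have "\<dots> = (C * norm x / cmod z) * norm (R z) + C * norm p / cmod z"
      using that(1) by (simp add: norm_divide field_simps)
    also have "\<dots> \<le> (1/2) * norm (R z) + C * norm p / cmod z"
      using that by (intro add_right_mono mult_right_mono) (auto simp: field_simps)
    finally show ?thesis by simp
  qed
  have contR: "isCont R z" for z
  proof -
    let ?m = "norm (R z)"
    have "((\<lambda>z'. R z' - R z) \<longlongrightarrow> 0) (at z)"
    proof (rule Lim_null_comparison)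
      have "\<forall>\<^sub>F z' in at z. dist z' z < 1 / (2 * C * ?m)"
        using \<open>C > 0\<close> R_norm_pos[of z] by (intro eventually_at_in_open'[of "ball z (1 / (2 * C * ?m))" z, simplified, THEN eventually_mono]) (auto simp: dist_commute)
      then show "\<forall>\<^sub>F z' in at z. norm (R z' - R z) \<le> 2 * ?m * (C * cmod (z' - z) * ?m)"
      proof eventually_elim
        case (elim z')
        have "C * cmod (z' - z) * ?m \<le> 1/2"
          using elim \<open>C > 0\<close> R_norm_pos[of z] by (simp add: dist_norm field_simps)
        then have "norm (R z') * (C * cmod (z' - z) * ?m) \<le> norm (R z') * (1/2)"
          by (intro mult_left_mono) auto
        then have "norm (R z') \<le> 2 * ?m"
          using resolvent_norm[of z' z] norm_triangle_sub[of "R z'" "R z"] by linarith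
        then show ?case
          using \<open>C > 0\<close> by (intro order_trans[OF resolvent_norm] mult_right_mono) auto
      qed
      have "((\<lambda>z'. 2 * ?m * (C * cmod (z' - z) * ?m)) \<longlongrightarrow> 2 * ?m * (C * cmod (z - z) * ?m)) (at z)"
        by (intro tendsto_intros)
      then show "((\<lambda>z'. 2 * ?m * (C * cmod (z' - z) * ?m)) \<longlongrightarrow> 0) (at z)" by simp
    qed
    then show ?thesis by (simp add: isCont_def LIM_zero_iff)
  qed
  have "\<exists>z0. \<forall>z. norm (R z) \<le> norm (R z0)"
  proof -
    \<comment> \<open>Beyond \<open>L\<close> the decay bound is at most \<open>norm (R 0)\<close>,
      so a maximum over the disc is global.\<close>
    define L where "L = max (2 * C * norm x) (2 * C * norm p / norm (R 0)) + 1"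
    have "2 * C * norm p / norm (R 0) > 0"
      using \<open>C > 0\<close> \<open>p \<noteq> 0\<close> R_norm_pos[of 0] by simp
    then have L: "L > 0" "L \<ge> 2 * C * norm x" "L \<ge> 2 * C * norm p / norm (R 0)"
      unfolding L_def by linarith+
    have "continuous_on (cball 0 L) (\<lambda>z. norm (R z))"
      by (intro continuous_on_norm continuous_at_imp_continuous_on ballI contR)
    moreover have "cball (0::complex) L \<noteq> {}" using L by auto
    ultimately obtain z0 where z0: "\<And>z. z \<in> cball 0 L \<Longrightarrow> norm (R z) \<le> norm (R z0)"
      using continuous_attains_sup[OF compact_cball] by metis
    have "norm (R z) \<le> norm (R z0)" for z
    proof (cases "z \<in> cball 0 L")
      case False
      then have z: "cmod z > L" by auto
      then have "norm (R z) \<le> 2 * C * norm p / cmod z"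
        using L by (intro decay) auto
      also have "\<dots> \<le> norm (R 0)"
      proof -
        have "2 * C * norm p \<le> L * norm (R 0)"
          using L(3) R_norm_pos[of 0] by (simp add: pos_divide_le_eq)
        also have "\<dots> \<le> cmod z * norm (R 0)"
          using z by (intro mult_right_mono) auto
        finally have "2 * C * norm p \<le> norm (R 0) * cmod z" by (simp add: mult.commute)
        moreover have "cmod z > 0" using z L(1) by linarith
        ultimately show ?thesis by (simp only: pos_divide_le_eq)
      qed
      also have "\<dots> \<le> norm (R z0)" using L by (intro z0) auto
      finally show ?thesis .
    qed (use z0 in auto)
    then show ?thesis by blast
  qed
  then obtain z0 where z0: "\<And>z. norm (R z) \<le> norm (R z0)" by blast
  define M where "M = norm (R z0)"
  have M: "norm (R z) \<le> M" for z using z0 by (simp add: M_def)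
  have "M > 0" using R_norm_pos by (simp add: M_def)

  have spread: "norm (R (z1 + r)) = M" if z1: "norm (R z1) = M" and r: "cmod r * M < 1" for z1 r
  proof -
    define w v where "w = x - h z1" and "v = R z1"
    \<comment> \<open>Powers with \<open>p\<close> as zeroth power, since the unit belongs to
      \<open>F\<close> and not to the type.\<close>
    define pw where "pw a n = (((*) a) ^^ n) p" for a :: 'a and n
    have pw_0: "pw a 0 = p" and pw_Suc: "pw a (Suc n) = a * pw a n" for a n
      by (auto simp: pw_def)
    have wF: "w \<in> F" and vF: "v \<in> F" by (auto simp: w_def v_def diffF xF hF RF)
    have pwF: "pw a n \<in> F" if "a \<in> F" for a n
      by (induction n) (auto simp: pw_0 pw_Suc pF multF that)
    have wv: "w * v = p" by (simp add: w_def v_def R1)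
    have pw_wv: "pw w n * pw v n = p" for n
    proof (induction n)
      case (Suc n)
      have "pw w (Suc n) * pw v (Suc n) = w * (pw w n * v) * pw v n"
        by (simp add: pw_Suc mult.assoc)
      also have "\<dots> = (w * v) * (pw w n * pw v n)"
        by (simp add: comF[OF pwF[OF wF] vF] mult.assoc)
      finally show ?case by (simp add: Suc wv p_left pF)
    qed (simp add: pw_0 p_left pF)
    have pw_w_pred: "pw w n * pw v (Suc n) = v" for n
    proof -
      have "pw w n * pw v (Suc n) = (pw w n * v) * pw v n" by (simp add: pw_Suc mult.assoc)
      also have "\<dots> = v * (pw w n * pw v n)" by (simp add: comF[OF pwF[OF wF] vF] mult.assoc)
      finally show ?thesis by (simp add: pw_wv p_right vF)
    qed
    have norm_pw_v: "norm (pw v (Suc n)) \<le> M ^ Suc n" for n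
    proof (induction n)
      case (Suc n)
      have "norm (pw v (Suc (Suc n))) \<le> norm v * norm (pw v (Suc n))"
        unfolding pw_Suc[of v "Suc n"] by (rule norm_mult_ineq)
      also have "\<dots> \<le> M * M ^ Suc n"
        using Suc z1 \<open>M > 0\<close> by (intro mult_mono) (auto simp: v_def)
      finally show ?case by simp
    qed (simp add: pw_0 pw_Suc p_right vF, simp add: v_def z1)
    have bound: "M - norm (R (z1 + r)) \<le> (M * C) * (real N * (cmod r * M) ^ N)" if "N > 0" for N
    proof -
      define \<sigma> where "\<sigma> k = cis (2 * pi * real k / real N) * r" for k
      have \<sigma>N: "\<sigma> k ^ N = r ^ N" for k
        using cis_root_unity_power[OF that, of k] by (simp add: \<sigma>_def power_mult_distrib)
      \<comment> \<open>Horner form of the sum of w^(n-1-m) \<sigma>^m over m < n, the cofactor of w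
        - \<sigma> in w^n - \<sigma>^n.\<close>
      define G where "G k n = rec_nat 0 (\<lambda>m g. w * g + h (\<sigma> k ^ m)) n" for k n
      have G_0: "G k 0 = 0" and G_Suc: "G k (Suc n) = w * G k n + h (\<sigma> k ^ n)" for k n
        by (auto simp: G_def)
      have GF: "G k (Suc n) \<in> F" for k n
      proof (induction n)
        case (Suc n)
        have "0 - h (\<sigma> k ^ Suc n) \<in> F" by (intro diffF hF) (metis h_0 hF)
        from diffF[OF multF[OF wF Suc] this] show ?case by (simp add: G_Suc[of k "Suc n"])
      qed (simp add: G_0 G_Suc hF)
      have telescope: "(w - h (\<sigma> k)) * G k n = pw w n - h (\<sigma> k ^ n)" for k n
      proof (induction n)
        case (Suc n)
        have "(w - h (\<sigma> k)) * G k (Suc n) = ((w - h (\<sigma> k)) * w) * G k n + (w - h (\<sigma> k)) * h (\<sigma> k ^ n)"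
          by (simp add: G_Suc algebra_simps)
        also have "(w - h (\<sigma> k)) * w = w * (w - h (\<sigma> k))"
          by (intro comF diffF wF hF)
        also have "w * (w - h (\<sigma> k)) * G k n = w * (pw w n - h (\<sigma> k ^ n))"
          by (simp add: mult.assoc Suc)
        finally show ?case by (simp add: pw_Suc h_mult algebra_simps)
      qed (simp add: G_0 pw_0 h_1)
      have RG: "R (z1 + \<sigma> k) * (pw w N - h (r ^ N)) = G k N" for k
      proof -
        have "x - h (z1 + \<sigma> k) = w - h (\<sigma> k)" by (simp add: w_def h_add)
        then have "R (z1 + \<sigma> k) * (w - h (\<sigma> k)) = p" using R2[of "z1 + \<sigma> k"] by simp
        then have "R (z1 + \<sigma> k) * (pw w N - h (r ^ N)) = p * G k N"
          by (metis telescope \<sigma>N mult.assoc)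
        then show ?thesis using p_left GF \<open>N > 0\<close> by (metis Suc_pred)
      qed
      have sum_h: "(\<Sum>k\<in>K. h (g k)) = h (\<Sum>k\<in>K. g k)" if "finite K" for K :: "nat set" and g
        using that by (induction K rule: finite_induct) (auto simp: h_0 h_add)
      have sumG: "(\<Sum>k<N. G k (Suc n)) = real N *\<^sub>R pw w n" if "n < N" for n
        using that
      proof (induction n)
        case 0
        then show ?case by (simp add: G_Suc G_0 h_1 pw_0 sum_constant_scaleR)
      next
        case (Suc n)
        have "(\<Sum>k<N. G k (Suc (Suc n))) = w * (\<Sum>k<N. G k (Suc n)) + h (\<Sum>k<N. \<sigma> k ^ Suc n)"
          by (simp add: G_Suc[of _ "Suc n"] sum.distrib sum_distrib_left sum_h)
        also have "(\<Sum>k<N. \<sigma> k ^ Suc n) = 0"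
          unfolding \<sigma>_def using Suc.prems by (intro sum_power_scaled_roots_unity) auto
        finally show ?case using Suc by (simp add: h_0 pw_Suc)
      qed
      obtain N' where N': "N = Suc N'" using \<open>N > 0\<close> by (cases N) auto
      define U where "U = (\<Sum>k<N. R (z1 + \<sigma> k))"
      have Up: "U * p = U"
        by (simp add: U_def sum_distrib_right p_right RF)
      \<comment> \<open>Partial fractions: the sum of 1/(w - \<sigma>) over the points \<sigma> is N
        w^(N-1) / (w^N - r^N). Multiplying by \<open>pw v N\<close> then gives \<open>N\<close>
        times \<open>v\<close> up to an error with the factor r^N v^N.\<close>
      have "U * (pw w N - h (r ^ N)) = real N *\<^sub>R pw w N'"
      proof -
        have "U * (pw w N - h (r ^ N)) = (\<Sum>k<N. G k N)"
          by (simp add: U_def sum_distrib_right RG)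
        then show ?thesis using sumG[of N'] N' by (metis lessI)
      qed
      then have "U * (pw w N - h (r ^ N)) * pw v N = real N *\<^sub>R (pw w N' * pw v N)"
        by simp
      then have "real N *\<^sub>R v = U - U * (h (r ^ N) * pw v N)"
        using pw_w_pred[of N', folded N'] pw_wv[of N] by (simp add: algebra_simps Up)
      then have "norm (real N *\<^sub>R v) \<le> norm U + norm (U * (h (r ^ N) * pw v N))"
        by (metis norm_triangle_ineq4)
      then have "real N * M \<le> norm U + norm (U * (h (r ^ N) * pw v N))"
        using z1 by (simp add: v_def)
      moreover have "norm (U * (h (r ^ N) * pw v N)) \<le> norm U * (C * cmod (r ^ N) * M ^ N)"
        using \<open>C > 0\<close> norm_pw_v[of N'] N'
        by (intro order_trans[OF norm_mult_ineq] mult_left_mono mult_mono h_norm) auto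
      \<comment> \<open>\<open>\<sigma> 0\<close> is \<open>r\<close>, so one summand is the value
        to be bounded below. The other \<open>N'\<close> are at most \<open>M\<close>, and
        cancelling them leaves the deficit of this single summand.\<close>
      moreover have "norm U \<le> norm (R (z1 + r)) + real N' * M"
      proof -
        have "norm U \<le> (\<Sum>k<N. norm (R (z1 + \<sigma> k)))" unfolding U_def by (rule norm_sum)
        also have "\<dots> = norm (R (z1 + \<sigma> 0)) + (\<Sum>k<N'. norm (R (z1 + \<sigma> (Suc k))))"
          unfolding N' by (rule sum.lessThan_Suc_shift)
        also have "(\<Sum>k<N'. norm (R (z1 + \<sigma> (Suc k)))) \<le> real N' * M"
          using sum_bounded_above[of "{..<N'}" "\<lambda>k. norm (R (z1 + \<sigma> (Suc k)))" M] M by simp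
        finally show ?thesis by (simp add: \<sigma>_def)
      qed
      moreover have "norm U * (C * cmod (r ^ N) * M ^ N) \<le> (real N * M) * (C * cmod (r ^ N) * M ^ N)"
      proof (rule mult_right_mono)
        have "norm U \<le> (\<Sum>k<N. norm (R (z1 + \<sigma> k)))" unfolding U_def by (rule norm_sum)
        also have "\<dots> \<le> real N * M"
          using sum_bounded_above[of "{..<N}" "\<lambda>k. norm (R (z1 + \<sigma> k))" M] M by simp
        finally show "norm U \<le> real N * M" .
      qed (use \<open>C > 0\<close> \<open>M > 0\<close> in auto)
      ultimately have "real N * M \<le> norm (R (z1 + r)) + real N' * M + (real N * M) * (C * cmod (r ^ N) * M ^ N)"
        by linarith
      moreover have "real N * M = M + real N' * M" by (simp add: N' algebra_simps)
      ultimately have "M - norm (R (z1 + r)) \<le> (real N * M) * (C * cmod (r ^ N) * M ^ N)" by linarith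
      then show ?thesis by (simp add: norm_power power_mult_distrib mult_ac)
    qed
    have "(\<lambda>N. (M * C) * (real N * (cmod r * M) ^ N)) \<longlonglongrightarrow> 0"
      using r \<open>M > 0\<close> by (intro tendsto_mult_right_zero powser_times_n_limit_0) auto
    then have "M - norm (R (z1 + r)) \<le> 0"
      by (rule LIMSEQ_le_const) (use bound in \<open>auto intro!: exI[of _ 1]\<close>)
    then show ?thesis using M[of "z1 + r"] by simp
  qed
  \<comment> \<open>Steps of this length keep \<open>cmod r * M\<close> at 1/2, as
    \<open>spread\<close> requires; enough of them reach the region where \<open>decay\<close>
    forbids the value \<open>M\<close>.\<close>
  define r where "r = complex_of_real (1 / (2 * M))"
  have const: "norm (R (z0 + of_nat k * r)) = M" for k
  proof (induction k)
    case (Suc k)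
    have "norm (R ((z0 + of_nat k * r) + r)) = M"
      by (rule spread[OF Suc]) (use \<open>M > 0\<close> in \<open>simp add: r_def norm_divide\<close>)
    then show ?case by (simp add: algebra_simps)
  qed (simp add: M_def)
  define L where "L = max (2 * C * norm x) (2 * C * norm p / M) + 1"
  have "2 * C * norm p / M > 0"
    using \<open>C > 0\<close> \<open>p \<noteq> 0\<close> \<open>M > 0\<close> by simp
  then have L: "L > 0" "L \<ge> 2 * C * norm x" "L > 2 * C * norm p / M"
    unfolding L_def by linarith+
  obtain k :: nat where k: "real k > (L + cmod z0) * (2 * M)"
    using reals_Archimedean2 by blast
  define z where "z = z0 + of_nat k * r"
  have "cmod (of_nat k * r) \<le> cmod z + cmod z0"
    using norm_triangle_ineq4[of z z0] by (simp add: z_def)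
  moreover have "cmod (of_nat k * r) = real k / (2 * M)"
    using \<open>M > 0\<close> by (simp add: r_def norm_mult norm_divide)
  moreover have "real k / (2 * M) > L + cmod z0"
    using k \<open>M > 0\<close> by (simp add: field_simps)
  ultimately have z: "cmod z > L" by linarith
  then have "M \<le> 2 * C * norm p / cmod z"
    using decay[of z] const[of k, folded z_def] L by linarith
  then have "cmod z * M \<le> 2 * C * norm p"
    using pos_le_divide_eq[of "cmod z" M "2 * C * norm p"] z L(1) by (simp only: mult.commute[of M])
  moreover have "2 * C * norm p < L * M" using L(3) \<open>M > 0\<close> by (simp add: field_simps)
  moreover have "L * M \<le> cmod z * M" using z \<open>M > 0\<close> by (intro mult_right_mono) auto
  ultimately show False by linarith
qed

section \<open>Derivations of the commutative corner\<close>

text \<open>\<open>left_mult_commute\<close> says that commutators lie in the right annihilator: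
  commutativity of the quotient, stated without the quotient.\<close>

locale comm_right_unital =
  fixes e :: "'a::{real_normed_algebra, banach}"
  assumes right_id: "a * e = a"
    and left_mult_commute: "x * (a * b) = x * (b * a)"
begin

text \<open>This is \<open>e A\<close>, as left multiplication by \<open>e\<close> is idempotent;
  the equational form makes closedness immediate.\<close>

definition B :: "'a set" where "B = {a. e * a = a}"

lemma B_D: "a \<in> B \<Longrightarrow> e * a = a"
  by (simp add: B_def)

lemma mult_e_left: "x * (e * y) = x * y"
  by (metis mult.assoc right_id)

lemma e_mult_in_B: "e * a \<in> B"
  by (simp add: B_def mult_e_left)

lemma e_in_B: "e \<in> B"
  by (simp add: B_def right_id)

lemma subspace_B: "subspace B"
  by (auto simp: subspace_def B_def algebra_simps)

lemma mult_in_B: "a \<in> B \<Longrightarrow> a * b \<in> B"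
  by (simp add: B_def mult.assoc[symmetric])

lemma B_commute: "a \<in> B \<Longrightarrow> b \<in> B \<Longrightarrow> a * b = b * a"
  by (metis B_D left_mult_commute mult.assoc)

lemma B_left_commute: "a \<in> B \<Longrightarrow> b \<in> B \<Longrightarrow> a * (b * y) = b * (a * y)"
  by (metis B_commute mult.assoc)

lemma closed_B: "closed B"
  unfolding B_def by (intro closed_Collect_eq continuous_intros)

lemma invertible_if_near_e:
  assumes "y \<in> B" "norm y < 1"
  shows "\<exists>v\<in>B. (e - y) * v = e"
proof -
  obtain s where s: "s = y + y * s" using quasi_inverse_exists[OF assms(2)] by blast
  have "s \<in> B" using s mult_in_B[OF assms(1)] subspace_add[OF subspace_B] assms(1) by metis
  moreover have "(e - y) * (e + s) = e + s - (y + y * s)"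
    using B_D[OF \<open>s \<in> B\<close>] by (simp add: algebra_simps right_id)
  ultimately show ?thesis
    using s subspace_add[OF subspace_B e_in_B] by (intro bexI[of _ "e + s"]) auto
qed

text \<open>The cofactor is e + g + ... + g^(n-1). One power of \<open>g\<close> with norm below 1
  thus suffices to invert \<open>e - g\<close>.\<close>

lemma one_minus_power_factor:
  assumes "g \<in> B"
  shows "\<exists>q\<in>B. e - (((*) g) ^^ n) e = (e - g) * q"
proof (induction n)
  case 0
  then show ?case using subspace_0[OF subspace_B] by (intro bexI[of _ 0]) auto
next
  case (Suc n)
  then obtain q where q: "q \<in> B" "e - (((*) g) ^^ n) e = (e - g) * q" by blast
  have "e - g * (((*) g) ^^ n) e = (e - g) + g * (e - (((*) g) ^^ n) e)"
    by (simp add: algebra_simps right_id)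
  also have "\<dots> = (e - g) * e + (e - g) * (g * q)"
    unfolding q(2) using B_left_commute[OF assms subspace_diff[OF subspace_B e_in_B assms]]
    by (simp add: right_id)
  finally have "e - (((*) g) ^^ Suc n) e = (e - g) * (e + g * q)"
    by (simp add: distrib_left)
  then show ?case
    using subspace_add[OF subspace_B e_in_B mult_in_B[OF assms]] by blast
qed

end

text \<open>\<open>D\<close> is defined on the whole type, so that Baire applies to its domain, with
  values in \<open>B\<close>. For \<open>e * d\<close> the product rule produces
  \<open>e * b * d y\<close>, which becomes \<open>b * (e * d y)\<close> through
  \<open>e * b = b\<close>; hence the restriction on \<open>b\<close>.\<close>

locale right_unital_derivation = comm_right_unital e
  for e :: "'a::{real_normed_algebra, banach}" +
  fixes D :: "'a \<Rightarrow> 'a"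
  assumes linD: "linear D"
    and e_D: "e * D y = D y"
    and D_mult: "b \<in> B \<Longrightarrow> D (b * y) = D b * y + b * D y"
begin

lemma D_in_B: "D y \<in> B"
  by (simp add: B_def e_D)

lemma D_e: "D e = 0"
  using D_mult[OF e_in_B, of e] by (simp add: right_id e_D)

lemma D_e_mult: "D (e * y) = D y"
  by (simp add: D_mult e_in_B D_e e_D)

text \<open>The Kleinecke--Shirokov argument: with \<open>\<Delta>\<close> the inner derivation by left
  multiplication with \<open>x\<close>, one has \<open>\<Delta> D = - L\<close> for the left multiplication \<open>L\<close> by \<open>D x\<close> and
  \<open>\<Delta> L = 0\<close>, hence \<open>\<Delta>\<^sup>n (D\<^sup>n) = (-1)\<^sup>n n! L\<^sup>n\<close>, whereas the left side grows at most
  geometrically.\<close>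

lemma commutator_power_derivation:
  assumes x: "x \<in> B"
  defines "\<Delta> \<equiv> \<lambda>F y. x * F y - F (x * y)"
  shows "(\<Delta> ^^ n) (D ^^ n) = (\<lambda>y. ((-1) ^ n * fact n) *\<^sub>R (((*) (D x)) ^^ n) y)"
proof -
  have \<Delta>_app: "\<Delta> F y = x * F y - F (x * y)" for F y by (simp add: \<Delta>_def)
  \<comment> \<open>\<Delta> obeys the Leibniz rule on compositions. It sends \<open>D\<close> to
    minus left multiplication by \<open>D x\<close>, and that multiplication to 0, so only two terms
    survive.\<close>
  have leibniz: "(\<Delta> ^^ Suc n) (\<lambda>y. D (F y))
      = (\<lambda>y. D ((\<Delta> ^^ Suc n) F y) - real (Suc n) *\<^sub>R (D x * (\<Delta> ^^ n) F y))" for n and F :: "'a \<Rightarrow> 'a"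
  proof (induction n)
    case 0
    show ?case by (simp add: \<Delta>_def fun_eq_iff linear_diff[OF linD] D_mult[OF x])
  next
    case (Suc n)
    define H where "H = (\<Delta> ^^ n) F"
    have "(\<Delta> ^^ Suc (Suc n)) (\<lambda>y. D (F y)) = \<Delta> (\<lambda>y. D (\<Delta> H y) - real (Suc n) *\<^sub>R (D x * H y))"
      using Suc by (simp add: H_def)
    also have "\<dots> = (\<lambda>y. D (\<Delta> (\<Delta> H) y) - real (Suc (Suc n)) *\<^sub>R (D x * \<Delta> H y))"
    proof
      fix y
      have "\<Delta> (\<lambda>y. D (\<Delta> H y) - real (Suc n) *\<^sub>R (D x * H y)) y
          = (x * D (\<Delta> H y) - D (\<Delta> H (x * y))) - real (Suc n) *\<^sub>R (x * (D x * H y) - D x * H (x * y))"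
        by (simp add: \<Delta>_def algebra_simps)
      also have "x * D (\<Delta> H y) - D (\<Delta> H (x * y)) = D (\<Delta> (\<Delta> H) y) - D x * \<Delta> H y"
        by (simp add: \<Delta>_app[of "\<Delta> H"] linear_diff[OF linD] D_mult[OF x])
      also have "x * (D x * H y) - D x * H (x * y) = D x * \<Delta> H y"
        by (simp add: \<Delta>_def B_left_commute[OF x D_in_B] right_diff_distrib)
      finally show "\<Delta> (\<lambda>y. D (\<Delta> H y) - real (Suc n) *\<^sub>R (D x * H y)) y
          = D (\<Delta> (\<Delta> H) y) - real (Suc (Suc n)) *\<^sub>R (D x * \<Delta> H y)"
        by (simp add: algebra_simps scaleR_2)
    qed
    finally show ?case by (simp add: H_def)
  qed
  have \<Delta>_0: "\<Delta> (\<lambda>_. 0) = (\<lambda>_. 0)" by (simp add: \<Delta>_def)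
  \<comment> \<open>The second equation makes the summand \<open>D (...)\<close> of
    \<open>leibniz\<close> vanish in the next induction step.\<close>
  have "(\<Delta> ^^ n) (D ^^ n) = (\<lambda>y. ((-1) ^ n * fact n) *\<^sub>R (((*) (D x)) ^^ n) y)
      \<and> (\<Delta> ^^ Suc n) (D ^^ n) = (\<lambda>_. 0)"
  proof (induction n)
    case 0
    show ?case by (auto simp: \<Delta>_def)
  next
    case (Suc n)
    then have I1: "(\<Delta> ^^ n) (D ^^ n) = (\<lambda>y. ((-1) ^ n * fact n) *\<^sub>R (((*) (D x)) ^^ n) y)"
      and I2: "(\<Delta> ^^ Suc n) (D ^^ n) = (\<lambda>_. 0)" by auto
    have I3: "(\<Delta> ^^ Suc (Suc n)) (D ^^ n) = (\<lambda>_. 0)"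
      using I2 \<Delta>_0 by simp
    have D_Suc: "D ^^ Suc n = (\<lambda>y. D ((D ^^ n) y))" by auto
    show ?case
      unfolding D_Suc leibniz I1 I2 I3 by (simp add: linear_0[OF linD] fun_eq_iff algebra_simps)
  qed
  then show ?thesis by blast
qed

text \<open>The closed form of \<Delta>^n (D^n) supplies the factorial, while each \<Delta> costs at
  most a factor \<open>2 * norm x\<close> and each \<open>D\<close> a factor
  \<open>C\<close>.\<close>

lemma bounded_derivation_power_bound:
  assumes x: "x \<in> B" and C: "\<And>y. norm (D y) \<le> C * norm y" "C \<ge> 0"
  shows "fact n * norm ((((*) (D x)) ^^ n) y) \<le> (2 * norm x * C) ^ n * norm y"
proof -
  define \<Delta> where "\<Delta> = (\<lambda>F y. x * F y - F (x * y))"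
  have D_pow: "norm ((D ^^ n) y) \<le> C ^ n * norm y" for n y
  proof (induction n)
    case (Suc n)
    have "norm ((D ^^ Suc n) y) \<le> C * norm ((D ^^ n) y)" using C(1) by simp
    also have "\<dots> \<le> C * (C ^ n * norm y)" by (intro mult_left_mono Suc C(2))
    finally show ?case by (simp add: mult.assoc)
  qed simp
  have \<Delta>_pow: "norm ((\<Delta> ^^ n) F y) \<le> (2 * norm x) ^ n * K * norm y"
    if "\<And>y. norm (F y) \<le> K * norm y" "K \<ge> 0" for n F K y
  proof (induction n arbitrary: y)
    case 0
    then show ?case using that by simp
  next
    case (Suc n)
    let ?k = "(2 * norm x) ^ n * K"
    have "norm ((\<Delta> ^^ Suc n) F y) \<le> norm (x * (\<Delta> ^^ n) F y) + norm ((\<Delta> ^^ n) F (x * y))"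
      by (simp add: \<Delta>_def norm_triangle_ineq4)
    also have "norm (x * (\<Delta> ^^ n) F y) \<le> norm x * (?k * norm y)"
      by (intro order_trans[OF norm_mult_ineq] mult_left_mono Suc) auto
    also have "norm ((\<Delta> ^^ n) F (x * y)) \<le> ?k * (norm x * norm y)"
      using that(2) by (intro order_trans[OF Suc] mult_left_mono norm_mult_ineq) auto
    finally show ?case by (simp add: algebra_simps)
  qed
  have "fact n * norm ((((*) (D x)) ^^ n) y) = norm ((\<Delta> ^^ n) (D ^^ n) y)"
    using commutator_power_derivation[OF x, of n] by (simp add: \<Delta>_def abs_mult)
  also have "\<dots> \<le> (2 * norm x) ^ n * C ^ n * norm y"
    using D_pow C(2) by (intro \<Delta>_pow) auto
  finally show ?thesis by (simp add: power_mult_distrib)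
qed

text \<open>Powers of \<open>c * D x\<close> split by commutativity into powers of \<open>c\<close>
  and of \<open>D x\<close>, so the factorial decay survives and some power has norm below 1. Hence
  \<open>D x\<close> lies in the radical of \<open>B\<close>.\<close>

lemma bounded_derivation_quasi_invertible:
  assumes x: "x \<in> B" and C: "\<And>y. norm (D y) \<le> C * norm y" "C \<ge> 0" and c: "c \<in> B"
  shows "\<exists>v\<in>B. v * (e - c * D x) = e"
proof -
  define g where "g = c * D x"
  have gB: "g \<in> B" by (simp add: g_def mult_in_B c)
  define K where "K = norm c * (2 * norm x * C)"
  have g_pow: "(((*) g) ^^ n) e = (((*) c) ^^ n) ((((*) (D x)) ^^ n) e)" for n
  proof (induction n)
    case (Suc n)
    have "D x * (((*) c) ^^ n) y = (((*) c) ^^ n) (D x * y)" for y n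
      by (induction n) (auto simp: B_left_commute[OF D_in_B c])
    then have *: "D x * (((*) g) ^^ n) e = (((*) c) ^^ n) (D x * (((*) (D x)) ^^ n) e)"
      unfolding Suc .
    have "(((*) g) ^^ Suc n) e = g * (((*) g) ^^ n) e" by simp
    also have "\<dots> = c * (D x * (((*) g) ^^ n) e)" unfolding g_def by (rule mult.assoc)
    finally show ?case unfolding * by simp
  qed simp
  have c_pow: "norm ((((*) c) ^^ n) y) \<le> norm c ^ n * norm y" for n y
  proof (induction n)
    case (Suc n)
    have "norm ((((*) c) ^^ Suc n) y) \<le> norm c * norm ((((*) c) ^^ n) y)" by (simp add: norm_mult_ineq)
    also have "\<dots> \<le> norm c * (norm c ^ n * norm y)" by (intro mult_left_mono Suc) auto
    finally show ?case by (simp add: mult.assoc)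
  qed simp
  have bound: "norm ((((*) g) ^^ n) e) \<le> K ^ n / fact n * norm e" for n
  proof -
    have "norm ((((*) g) ^^ n) e) \<le> norm c ^ n * norm ((((*) (D x)) ^^ n) e)"
      unfolding g_pow by (rule c_pow)
    also have "\<dots> \<le> norm c ^ n * ((2 * norm x * C) ^ n * norm e / fact n)"
      using bounded_derivation_power_bound[OF x C, of n e]
      by (intro mult_left_mono) (auto simp: field_simps)
    finally show ?thesis by (simp add: K_def power_mult_distrib)
  qed
  have "(\<lambda>n. K ^ n / fact n * norm e) \<longlonglongrightarrow> 0"
    using summable_LIMSEQ_zero[OF summable_exp[of K]]
    by (intro tendsto_mult_left_zero) (simp add: field_simps)
  then have "\<forall>\<^sub>F n in sequentially. K ^ n / fact n * norm e < 1"
    by (rule order_tendstoD) auto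
  then obtain n where "K ^ n / fact n * norm e < 1" by (auto simp: eventually_sequentially)
  then have small: "norm ((((*) g) ^^ n) e) < 1" using bound[of n] by linarith
  have "(((*) g) ^^ n) e \<in> B" by (cases n) (auto simp: e_in_B mult_in_B gB)
  from invertible_if_near_e[OF this small] one_minus_power_factor[OF gB, of n]
  obtain v q where v: "v \<in> B" "(e - (((*) g) ^^ n) e) * v = e" and q: "q \<in> B" "e - (((*) g) ^^ n) e = (e - g) * q"
    by blast
  have "(e - g) * (q * v) = e" using v(2) q(2) by (simp add: mult.assoc)
  moreover have "e - g \<in> B" by (rule subspace_diff[OF subspace_B e_in_B gB])
  ultimately show ?thesis
    using mult_in_B[OF q(1), of v] B_commute[of "e - g" "q * v"] by (metis g_def)
qed

end

section \<open>Multiples of the separating space of a derivation\<close>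

context right_unital_derivation
begin

abbreviation S :: "'a set" where "S \<equiv> separating_space D"

lemma subspace_S: "subspace S"
  by (rule subspace_separating_space[OF linD])

lemma S_subset_B: "S \<subseteq> B"
proof
  fix s assume "s \<in> S"
  then obtain y where "(\<lambda>n. D (y n)) \<longlonglongrightarrow> s" by (auto elim: separating_spaceE)
  then show "s \<in> B" by (rule closed_sequentially[OF closed_B _, rotated]) (simp add: D_in_B)
qed

lemma B_mult_S:
  assumes "b \<in> B" "s \<in> S"
  shows "b * s \<in> S"
proof -
  obtain y where y: "y \<longlonglongrightarrow> 0" "(\<lambda>n. D (y n)) \<longlonglongrightarrow> s" using assms(2) by (auto elim: separating_spaceE)
  show ?thesis
  proof (rule separating_spaceI)
    show "(\<lambda>n. b * y n) \<longlonglongrightarrow> 0" by (rule tendsto_mult_right_zero[OF y(1)])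
    have "(\<lambda>n. D b * y n + b * D (y n)) \<longlonglongrightarrow> D b * 0 + b * s"
      by (intro tendsto_intros y)
    then show "(\<lambda>n. D (b * y n)) \<longlonglongrightarrow> b * s" by (simp add: D_mult[OF assms(1)])
  qed
qed

lemma subspace_mult_image: "subspace ((*) c ` S)"
  by (intro linear_subspace_image subspace_S linearI) (auto simp: algebra_simps)

text \<open>A gliding hump: if the chain decreased strictly, then modulo \<open>c\<^sub>n\<^sub>+\<^sub>1 S\<close> the map
  \<open>y \<mapsto> D (c\<^sub>n y)\<close> would be unbounded and \<open>y \<mapsto> D (c\<^sub>n\<^sub>+\<^sub>1 y)\<close> bounded for every \<open>n\<close>, so a
  rapidly convergent series \<open>X = \<Sum> c\<^sub>n x\<^sub>n\<close> could be chosen with \<open>norm (D X) > n\<close> for all \<open>n\<close>.\<close>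

lemma separating_space_chain_stabilizes:
  assumes a1: "\<And>n. norm (a n) \<le> 1"
    and cB: "\<And>n. c n \<in> B" and c_Suc: "\<And>n. c (Suc n) = c n * a n"
  shows "\<exists>n. \<forall>s\<in>S. c n * s \<in> closure ((*) (c (Suc n)) ` S)"
proof (rule ccontr)
  assume "\<not> ?thesis"
  then have strict: "\<exists>s\<in>S. c n * s \<notin> closure ((*) (c (Suc n)) ` S)" for n by blast
  define q where "q n v = infdist v ((*) (c n) ` S)" for n v
  have q_add: "q n (u + v) \<le> q n u + q n v" for n u v
    unfolding q_def by (rule infdist_subspace_add[OF subspace_mult_image])
  have q_norm: "q n v \<le> norm v" for n v
    unfolding q_def by (rule infdist_subspace_le_norm[OF subspace_mult_image])
  obtain C where C: "\<And>y. \<exists>s\<in>S. norm (D y - s) \<le> C * norm y"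
    using linear_bounded_modulo_separating_space[OF linD] by blast
  have "\<exists>K\<ge>0. \<forall>y. q n (D (c n * y)) \<le> K * norm y" for n
  proof (intro exI conjI allI)
    \<comment> \<open>\<open>D (c n * y)\<close> differs from \<open>c n * s\<close>, whose distance
      is 0, by \<open>D (c n) * y + c n * (D y - s)\<close>.\<close>
    let ?K = "norm (D (c n)) + norm (c n) * \<bar>C\<bar>"
    show "?K \<ge> 0" by simp
    fix y
    obtain s where s: "s \<in> S" "norm (D y - s) \<le> C * norm y" using C by blast
    have "q n (D (c n * y)) \<le> dist (D (c n * y)) (c n * s)"
      unfolding q_def using s by (intro infdist_le) auto
    also have "\<dots> = norm (D (c n) * y + c n * (D y - s))"
      by (simp add: dist_norm D_mult[OF cB] algebra_simps)
    also have "\<dots> \<le> norm (D (c n)) * norm y + norm (c n) * norm (D y - s)"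
      by (intro norm_triangle_le add_mono norm_mult_ineq)
    also have "\<dots> \<le> norm (D (c n)) * norm y + norm (c n) * (\<bar>C\<bar> * norm y)"
      using s(2) mult_right_mono[OF abs_ge_self[of C] norm_ge_zero[of y]]
      by (intro add_left_mono mult_left_mono) auto
    finally show "q n (D (c n * y)) \<le> ?K * norm y"
      by (simp add: algebra_simps)
  qed
  then obtain K where K0: "\<And>n. K n \<ge> 0" and K: "\<And>n y. q n (D (c n * y)) \<le> K n * norm y" by metis
  \<comment> \<open>Elements \<open>y k\<close> tending to 0 with \<open>D (y k)\<close> tending to
    \<open>t *\<^sub>R s\<close> make \<open>D (c n * y k)\<close> tend to
    \<open>c n * (t *\<^sub>R s)\<close>, and \<open>t\<close> pushes the distance of this limit
    beyond \<open>N\<close>.\<close>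
  have unbounded: "\<exists>y. norm y < \<epsilon> \<and> q (Suc n) (D (c n * y)) > N" if "\<epsilon> > 0" for n \<epsilon> N
  proof -
    obtain s where s: "s \<in> S" "c n * s \<notin> closure ((*) (c (Suc n)) ` S)" using strict by blast
    have "(*) (c (Suc n)) ` S \<noteq> {}" using s(1) by blast
    then have \<eta>: "q (Suc n) (c n * s) > 0"
      using s(2) infdist_nonneg[of "c n * s" "(*) (c (Suc n)) ` S"] unfolding q_def
      by (simp add: in_closure_iff_infdist_zero)
    define t where "t = (\<bar>N\<bar> + 1) / q (Suc n) (c n * s)"
    have "t > 0" using \<eta> by (simp add: t_def)
    have "N < t * q (Suc n) (c n * s)" using \<eta> by (simp add: t_def)
    also have "\<dots> \<le> q (Suc n) (c n * (t *\<^sub>R s))"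
      using infdist_subspace_scaleR_ge[OF subspace_mult_image \<open>t > 0\<close>] by (simp add: q_def)
    finally have big: "N < q (Suc n) (c n * (t *\<^sub>R s))" .
    have "t *\<^sub>R s \<in> S" by (rule subspace_scale[OF subspace_S s(1)])
    then obtain y where y: "y \<longlonglongrightarrow> 0" "(\<lambda>k. D (y k)) \<longlonglongrightarrow> t *\<^sub>R s" by (auto elim: separating_spaceE)
    have "(\<lambda>k. D (c n) * y k + c n * D (y k)) \<longlonglongrightarrow> D (c n) * 0 + c n * (t *\<^sub>R s)"
      by (intro tendsto_intros y)
    then have "(\<lambda>k. D (c n * y k)) \<longlonglongrightarrow> c n * (t *\<^sub>R s)" by (simp add: D_mult[OF cB])
    then have "(\<lambda>k. q (Suc n) (D (c n * y k))) \<longlonglongrightarrow> q (Suc n) (c n * (t *\<^sub>R s))"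
      unfolding q_def by (rule tendsto_infdist)
    from order_tendstoD(1)[OF this big] order_tendstoD(2)[OF tendsto_norm_zero[OF y(1)] \<open>\<epsilon> > 0\<close>]
    have "\<forall>\<^sub>F k in sequentially. norm (y k) < \<epsilon> \<and> q (Suc n) (D (c n * y k)) > N"
      by eventually_elim auto
    then show ?thesis by (auto simp: eventually_sequentially)
  qed
  \<comment> \<open>Each term outweighs the image of the partial sum before it and also the tail
    still to be chosen: \<open>2 * norm e\<close> will bound every cofactor
    \<open>Y m\<close>.\<close>
  have "\<exists>f. \<forall>n. (n = 0 \<longrightarrow> f n = 0) \<and> (\<exists>y. f (Suc n) = f n + c n * y \<and> norm y < (1/2) ^ n
      \<and> q (Suc n) (D (c n * y)) > real n + norm (D (f n)) + K (Suc n) * (2 * norm e))"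
  proof (rule dependent_nat_choice)
    fix v and n :: nat
    obtain y where "norm y < (1/2) ^ n" "q (Suc n) (D (c n * y)) > real n + norm (D v) + K (Suc n) * (2 * norm e)"
      using unbounded[of "(1/2) ^ n"] by auto
    then show "\<exists>v'. (Suc n = 0 \<longrightarrow> v' = 0) \<and> (\<exists>y. v' = v + c n * y \<and> norm y < (1/2) ^ n
      \<and> q (Suc n) (D (c n * y)) > real n + norm (D v) + K (Suc n) * (2 * norm e))"
      by (intro exI[of _ "v + c n * y"] conjI exI[of _ y]) auto
  qed auto
  then obtain f x where f0: "f 0 = 0" and f_Suc: "\<And>n. f (Suc n) = f n + c n * x n"
    and x: "\<And>n. norm (x n) < (1/2) ^ n"
    and hump: "\<And>n. q (Suc n) (D (c n * x n)) > real n + norm (D (f n)) + K (Suc n) * (2 * norm e)"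
    by metis
  have f_sum: "f n = (\<Sum>j<n. c j * x j)" for n
    by (induction n) (auto simp: f0 f_Suc)
  \<comment> \<open>The product of \<open>a m\<close>, ..., \<open>a (m + j - 1)\<close>, beginning
    with \<open>e\<close>. It allows \<open>c m\<close> to be taken out of the whole tail, to which
    \<open>K m\<close> then applies.\<close>
  define pr where "pr m j = rec_nat e (\<lambda>i g. g * a (m + i)) j" for m j
  have pr_0: "pr m 0 = e" and pr_Suc: "pr m (Suc j) = pr m j * a (m + j)" for m j
    by (auto simp: pr_def)
  have c_pr: "c m * pr m j = c (m + j)" for m j
    by (induction j) (auto simp: pr_0 pr_Suc right_id c_Suc mult.assoc[symmetric])
  have norm_pr: "norm (pr m j) \<le> norm e" for m j
  proof (induction j)
    case (Suc j)
    have "norm (pr m (Suc j)) \<le> norm (pr m j) * norm (a (m + j))"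
      unfolding pr_Suc by (rule norm_mult_ineq)
    also have "\<dots> \<le> norm e * 1" by (intro mult_mono Suc a1) auto
    finally show ?case by simp
  qed (simp add: pr_0)
  have geo: "(\<lambda>j. norm e * (1/2::real) ^ j) sums (2 * norm e)"
    using sums_mult[OF geometric_sums[of "1/2::real"], of "norm e"] by (simp add: mult.commute)
  define Y where "Y m = (\<Sum>j. pr m j * x (m + j))" for m
  have term_bound: "norm (pr m j * x (m + j)) \<le> norm e * (1/2) ^ j" for m j
  proof -
    have "norm (pr m j * x (m + j)) \<le> norm (pr m j) * norm (x (m + j))" by (rule norm_mult_ineq)
    also have "\<dots> \<le> norm e * (1/2) ^ (m + j)"
      using x[of "m + j"] by (intro mult_mono norm_pr) auto
    also have "\<dots> \<le> norm e * (1/2) ^ j"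
      by (intro mult_left_mono power_decreasing) auto
    finally show ?thesis .
  qed
  have sum_norm: "summable (\<lambda>j. norm (pr m j * x (m + j)))" for m
    by (rule summable_comparison_test[OF _ sums_summable[OF geo]]) (use term_bound in auto)
  have sum_Y: "summable (\<lambda>j. pr m j * x (m + j))" for m
    by (rule summable_norm_cancel[OF sum_norm])
  have norm_Y: "norm (Y m) \<le> 2 * norm e" for m
  proof -
    have "norm (Y m) \<le> (\<Sum>j. norm (pr m j * x (m + j)))"
      unfolding Y_def by (rule summable_norm[OF sum_norm])
    also have "\<dots> \<le> (\<Sum>j. norm e * (1/2::real) ^ j)"
      by (rule suminf_le[OF term_bound sum_norm sums_summable[OF geo]])
    finally show ?thesis using sums_unique[OF geo] by simp
  qed
  have c_Y: "(\<lambda>j. c (m + j) * x (m + j)) sums (c m * Y m)" for m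
    using sums_mult[OF summable_sums[OF sum_Y[of m]], of "c m"]
    by (simp add: Y_def mult.assoc[symmetric] c_pr)
  define X where "X = c 0 * Y 0"
  have X_split: "X = f m + c m * Y m" for m
  proof -
    have "(\<lambda>j. c j * x j) sums X" using c_Y[of 0] by (simp add: X_def)
    then have "(\<lambda>j. c (j + m) * x (j + m)) sums (X - f m)"
      unfolding f_sum by (rule sums_split_initial_segment)
    then show ?thesis
      using sums_unique2[OF c_Y[of m]] by (simp add: add.commute)
  qed
  have "real n < norm (D X)" for n
  proof -
    have "D X = D (f n) + D (c n * x n) + D (c (Suc n) * Y (Suc n))"
      using X_split[of "Suc n"] by (simp add: f_Suc linear_add[OF linD])
    then have "D (c n * x n) = (D X + D (- f n)) + D (c (Suc n) * (- Y (Suc n)))"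
      by (simp add: linear_neg[OF linD])
    then have "q (Suc n) (D (c n * x n))
        \<le> (q (Suc n) (D X) + q (Suc n) (D (- f n))) + q (Suc n) (D (c (Suc n) * (- Y (Suc n))))"
      using q_add[of "Suc n" "D X + D (- f n)" "D (c (Suc n) * (- Y (Suc n)))"]
        q_add[of "Suc n" "D X" "D (- f n)"] by simp
    also have "q (Suc n) (D X) \<le> norm (D X)" by (rule q_norm)
    also have "q (Suc n) (D (- f n)) \<le> norm (D (f n))"
      using q_norm[of "Suc n" "D (- f n)"] by (simp add: linear_neg[OF linD])
    also have "q (Suc n) (D (c (Suc n) * (- Y (Suc n)))) \<le> K (Suc n) * (2 * norm e)"
      using norm_Y[of "Suc n"] K0[of "Suc n"] by (intro order_trans[OF K] mult_left_mono) auto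
    finally show ?thesis using hump[of n] by linarith
  qed
  then show False using reals_Archimedean2[of "norm (D X)"] by (meson less_asym)
qed

text \<open>Otherwise every nonzero multiple of \<open>S\<close> could be shrunk, even in closure,
  to another nonzero one, and dependent choice would build a chain contradicting
  \<open>separating_space_chain_stabilizes\<close>.\<close>

lemma minimal_multiple_of_separating_space:
  assumes "\<exists>s\<in>S. s \<noteq> 0"
  shows "\<exists>c\<in>B. (\<exists>s\<in>S. c * s \<noteq> 0)
    \<and> (\<forall>b\<in>B. (\<exists>s\<in>S. c * b * s \<noteq> 0) \<longrightarrow> (\<forall>s\<in>S. c * s \<in> closure ((*) (c * b) ` S)))"
proof (rule ccontr)
  assume contra: "\<not> ?thesis"
  define P where "P c \<longleftrightarrow> c \<in> B \<and> (\<exists>s\<in>S. c * s \<noteq> 0)" for c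
  define Q where "Q c c' \<longleftrightarrow> (\<exists>b\<in>B. norm b \<le> 1 \<and> c' = c * b
      \<and> (\<exists>s\<in>S. c * s \<notin> closure ((*) c' ` S)))" for c c'
  have "\<exists>f. \<forall>n. P (f n) \<and> Q (f n) (f (Suc n))"
  proof (rule dependent_nat_choice)
    show "\<exists>c. P c"
      using assms S_subset_B B_D e_in_B unfolding P_def by (metis subsetD)
  next
    fix c assume "P c"
    with contra obtain b where b: "b \<in> B" "\<exists>s\<in>S. c * b * s \<noteq> 0" "\<exists>s\<in>S. c * s \<notin> closure ((*) (c * b) ` S)"
      unfolding P_def by blast
    have "b \<noteq> 0" using b(2) by auto
    \<comment> \<open>The factors of a chain need norm at most 1; rescaling \<open>b\<close> leaves
      the image of the subspace \<open>S\<close> unchanged.\<close>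
    define t where "t = inverse (norm b)"
    have "t > 0" using \<open>b \<noteq> 0\<close> by (simp add: t_def)
    have "(*) (c * (t *\<^sub>R b)) ` S = (*) (c * b) ` ((\<lambda>s. t *\<^sub>R s) ` S)"
      by (auto simp: image_image)
    also have "(\<lambda>s. t *\<^sub>R s) ` S = S"
    proof (intro equalityI subsetI)
      fix s assume "s \<in> S"
      then have "inverse t *\<^sub>R s \<in> S" "s = t *\<^sub>R (inverse t *\<^sub>R s)"
        using \<open>t > 0\<close> by (auto intro: subspace_scale[OF subspace_S])
      then show "s \<in> (\<lambda>s. t *\<^sub>R s) ` S" by blast
    qed (auto intro: subspace_scale[OF subspace_S])
    finally have img: "(*) (c * (t *\<^sub>R b)) ` S = (*) (c * b) ` S" .
    have "P (c * (t *\<^sub>R b))"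
      using b(2) \<open>t > 0\<close> \<open>P c\<close> mult_in_B[of c "t *\<^sub>R b"] by (auto simp: P_def)
    moreover have "Q c (c * (t *\<^sub>R b))"
      unfolding Q_def img
    proof (intro bexI[where x = "t *\<^sub>R b" and A = B] conjI b(3) refl)
      show "norm (t *\<^sub>R b) \<le> 1" using \<open>b \<noteq> 0\<close> by (simp add: t_def)
      show "t *\<^sub>R b \<in> B" by (rule subspace_scale[OF subspace_B b(1)])
    qed
    ultimately show "\<exists>c'. P c' \<and> Q c c'" by blast
  qed
  then obtain f where f: "\<And>n. P (f n)" "\<And>n. Q (f n) (f (Suc n))" by blast
  then have "\<forall>n. \<exists>b. norm b \<le> 1 \<and> f (Suc n) = f n * b" unfolding Q_def by blast
  then obtain a where "\<And>n. norm (a n) \<le> 1" "\<And>n. f (Suc n) = f n * a n" by metis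
  from separating_space_chain_stabilizes[of a f, OF this(1) _ this(2)] f show False
    unfolding P_def Q_def by blast
qed

end

section \<open>Vanishing of the derivation over a semisimple corner\<close>

locale semisimple_derivation = right_unital_derivation e D
  for e :: "'a::{real_normed_algebra, banach}" and D :: "'a \<Rightarrow> 'a" +
  fixes i :: 'a
  assumes i_in_B: "i \<in> B" and i_square: "i * i = - e"
    and semisimple: "b \<in> B \<Longrightarrow> b \<noteq> 0 \<Longrightarrow> \<exists>c\<in>B. \<not> (\<exists>v\<in>B. v * (e - c * b) = e)"
begin

lemma D_i: "D i = 0"
proof -
  have "D i * i + i * D i = D (- e)"
    using D_mult[OF i_in_B, of i] by (simp add: i_square)
  then have "2 *\<^sub>R (i * D i) = 0"
    by (simp add: linear_neg[OF linD] D_e B_commute[OF D_in_B i_in_B] scaleR_2)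
  then have "i * (i * D i) = 0" by simp
  then show ?thesis by (simp add: mult.assoc[symmetric] i_square e_D)
qed

lemma D_idempotent:
  assumes "p \<in> B" "p * p = p"
  shows "D p = 0"
proof -
  have "D p = p * D p + p * D p"
    using D_mult[OF assms(1), of p] B_commute[OF D_in_B assms(1)] by (simp add: assms(2))
  then have *: "D p = 2 *\<^sub>R (p * D p)" by (simp add: scaleR_2)
  then have "p * D p = 2 *\<^sub>R (p * (p * D p))" by (metis mult_scaleR_right)
  then have "p * D p = 2 *\<^sub>R (p * D p)" by (simp add: mult.assoc[symmetric] assms(2))
  then have "p * D p = 0" by (simp add: scaleR_2)
  then show ?thesis using * by simp
qed

text \<open>The embedding of the complex numbers in \<open>B\<close>, written with real scalars and
  the imaginary unit \<open>i\<close>.\<close>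

definition cscale :: "complex \<Rightarrow> 'a" where
  "cscale z = Re z *\<^sub>R e + Im z *\<^sub>R i"

lemma cscale_in_B: "cscale z \<in> B"
  unfolding cscale_def by (intro subspace_add[OF subspace_B] subspace_scale[OF subspace_B] e_in_B i_in_B)

lemma cscale_add: "cscale (z + w) = cscale z + cscale w"
  by (simp add: cscale_def algebra_simps)

lemma cscale_mult: "cscale (z * w) = cscale z * cscale w"
  by (simp add: cscale_def distrib_left distrib_right scaleR_add_left scaleR_diff_left scaleR_add_right scaleR_diff_right
      right_id i_square B_D[OF i_in_B] mult.commute)

lemma cscale_1: "cscale 1 = e"
  by (simp add: cscale_def)

lemma norm_cscale: "norm (cscale z) \<le> (norm e + norm i) * cmod z"
proof -
  have "norm (cscale z) \<le> \<bar>Re z\<bar> * norm e + \<bar>Im z\<bar> * norm i"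
    unfolding cscale_def by (intro norm_triangle_le) simp
  also have "\<dots> \<le> cmod z * norm e + cmod z * norm i"
    by (intro add_mono mult_right_mono abs_Re_le_cmod abs_Im_le_cmod) auto
  finally show ?thesis by (simp add: algebra_simps)
qed

text \<open>If \<open>S\<close> were nonzero, a minimal closed multiple \<open>T\<close> of it would be annihilated or mapped
  densely into itself by every element of \<open>B\<close>.  Semisimplicity then provides an identity \<open>p\<close> of
  \<open>T\<close>, so that \<open>T\<close> is a Banach field and equals the multiples of \<open>p\<close> by complex scalars.  But
  \<open>D\<close> vanishes on those.\<close>

lemma separating_space_trivial: "S = {0}"
proof (rule ccontr)
  assume "S \<noteq> {0}"
  then have "\<exists>s\<in>S. s \<noteq> 0" using subspace_0[OF subspace_S] by blast
  from minimal_multiple_of_separating_space[OF this] obtain c s0 where cB: "c \<in> B"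
    and s0: "s0 \<in> S" "c * s0 \<noteq> 0"
    and min: "\<And>b s. b \<in> B \<Longrightarrow> \<exists>s\<in>S. c * b * s \<noteq> 0 \<Longrightarrow> s \<in> S \<Longrightarrow> c * s \<in> closure ((*) (c * b) ` S)"
    by blast
  define T where "T = closure ((*) c ` S)"
  define t0 where "t0 = c * s0"
  have t0: "t0 \<in> T" "t0 \<noteq> 0" using s0 closure_subset[of "(*) c ` S"] by (auto simp: T_def t0_def)
  have T_B: "T \<subseteq> B"
    unfolding T_def by (rule closure_minimal[OF _ closed_B]) (auto simp: mult_in_B cB)
  have T_seq: "t \<in> T \<longleftrightarrow> (\<exists>g. (\<forall>n. g n \<in> S) \<and> (\<lambda>n. c * g n) \<longlonglongrightarrow> t)" for t
  proof
    assume "t \<in> T"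
    then obtain x where x: "\<And>n. x n \<in> (*) c ` S" "x \<longlonglongrightarrow> t"
      unfolding T_def closure_sequential by blast
    then have "\<forall>n. \<exists>s. s \<in> S \<and> x n = c * s" by blast
    then obtain g where "\<And>n. g n \<in> S" "\<And>n. x n = c * g n" by metis
    moreover from this have "x = (\<lambda>n. c * g n)" by auto
    ultimately show "\<exists>g. (\<forall>n. g n \<in> S) \<and> (\<lambda>n. c * g n) \<longlonglongrightarrow> t" using x(2) by blast
  next
    assume "\<exists>g. (\<forall>n. g n \<in> S) \<and> (\<lambda>n. c * g n) \<longlonglongrightarrow> t"
    then obtain g where "\<And>n. g n \<in> S" "(\<lambda>n. c * g n) \<longlonglongrightarrow> t" by blast
    then show "t \<in> T"
      unfolding T_def closure_sequential by (intro exI[of _ "\<lambda>n. c * g n"]) auto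
  qed
  have T_diff: "u - v \<in> T" if "u \<in> T" "v \<in> T" for u v
  proof -
    obtain g where g: "\<And>n. g n \<in> S" "(\<lambda>n. c * g n) \<longlonglongrightarrow> u" using \<open>u \<in> T\<close> T_seq by blast
    obtain k where k: "\<And>n. k n \<in> S" "(\<lambda>n. c * k n) \<longlonglongrightarrow> v" using \<open>v \<in> T\<close> T_seq by blast
    show ?thesis
      unfolding T_seq using tendsto_diff[OF g(2) k(2)] subspace_diff[OF subspace_S g(1) k(1)]
      by (intro exI[of _ "\<lambda>n. g n - k n"]) (auto simp: right_diff_distrib)
  qed
  have T_mult: "b * t \<in> T" if "b \<in> B" "t \<in> T" for b t
  proof -
    obtain g where g: "\<And>n. g n \<in> S" "(\<lambda>n. c * g n) \<longlonglongrightarrow> t" using \<open>t \<in> T\<close> T_seq by blast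
    have "(\<lambda>n. b * (c * g n)) \<longlonglongrightarrow> b * t" by (intro tendsto_intros g)
    then show ?thesis
      unfolding T_seq using B_mult_S[OF \<open>b \<in> B\<close> g(1)]
      by (intro exI[of _ "\<lambda>n. b * g n"]) (auto simp: B_left_commute[OF \<open>b \<in> B\<close> cB])
  qed
  have T_0: "0 \<in> T" using T_diff[OF t0(1) t0(1)] by simp
  have T_add: "u + v \<in> T" if "u \<in> T" "v \<in> T" for u v
    using T_diff[OF that(1) T_diff[OF T_0 that(2)]] by simp
  have T_commute: "u * v = v * u" if "u \<in> T" "v \<in> T" for u v
    using B_commute T_B that by blast
  have T_mult_right: "t * y \<in> T" if "t \<in> T" for t y
    using T_mult[OF e_mult_in_B that, of y] B_commute[OF e_mult_in_B, of t y] T_B that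
    by (metis mult_e_left subsetD)
  \<comment> \<open>By minimality \<open>b\<close> either kills \<open>T\<close> or maps it densely
    into \<open>T\<close>; approximation within 1 is what a Neumann series asks for.\<close>
  have dense: "\<exists>t'\<in>T. norm (t - b * t') < 1" if "b \<in> B" "t1 \<in> T" "b * t1 \<noteq> 0" "t \<in> T" for b t1 t
  proof -
    have "\<exists>s\<in>S. c * b * s \<noteq> 0"
    proof (rule ccontr)
      assume "\<not> ?thesis"
      then have z: "b * (c * s) = 0" if "s \<in> S" for s
        using that B_commute[OF \<open>b \<in> B\<close> cB] by (simp add: mult.assoc[symmetric])
      obtain g where g: "\<And>n. g n \<in> S" "(\<lambda>n. c * g n) \<longlonglongrightarrow> t1" using \<open>t1 \<in> T\<close> T_seq by blast
      have "(\<lambda>n. b * (c * g n)) \<longlonglongrightarrow> b * t1" by (intro tendsto_intros g)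
      then show False using that(3) by (simp add: z g(1) LIMSEQ_const_iff)
    qed
    then have "(*) c ` S \<subseteq> closure ((*) (c * b) ` S)" using min[OF \<open>b \<in> B\<close>] by blast
    then have "t \<in> closure ((*) (c * b) ` S)"
      using \<open>t \<in> T\<close> unfolding T_def by (meson closed_closure closure_minimal subsetD)
    then obtain s where s: "s \<in> S" "dist (c * b * s) t < 1"
      unfolding closure_approachable using zero_less_one by blast
    have "c * s \<in> T" using s(1) closure_subset[of "(*) c ` S"] by (auto simp: T_def)
    moreover have "c * b * s = b * (c * s)"
      by (simp add: B_commute[OF \<open>b \<in> B\<close> cB] mult.assoc[symmetric])
    ultimately show ?thesis using s(2) by (auto simp: dist_norm norm_minus_commute)
  qed

  obtain c' where c': "c' \<in> B" "\<not> (\<exists>v\<in>B. v * (e - c' * t0) = e)"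
    using semisimple[of t0] t0 T_B by blast
  define p where "p = c' * t0"
  have pT: "p \<in> T" unfolding p_def by (rule T_mult[OF c'(1) t0(1)])
  then have pB: "p \<in> B" using T_B by blast
  have epB: "e - p \<in> B" by (rule subspace_diff[OF subspace_B e_in_B pB])
  \<comment> \<open>If \<open>e - p\<close> did not kill \<open>T\<close>, some
    \<open>(e - p) * t'\<close> would be within 1 of \<open>p\<close>. Then
    \<open>(e - p) * (e + t')\<close> would be invertible, against the choice of
    \<open>c'\<close>.\<close>
  have p_left: "p * t = t" if "t \<in> T" for t
  proof (rule ccontr)
    assume "p * t \<noteq> t"
    then have "(e - p) * t \<noteq> 0" using B_D T_B that by (auto simp: left_diff_distrib)
    from dense[OF epB that this pT] obtain t' where t': "t' \<in> T" "norm (p - (e - p) * t') < 1" by blast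
    define y where "y = p - (e - p) * t'"
    have "y \<in> B" unfolding y_def by (rule subspace_diff[OF subspace_B pB mult_in_B[OF epB]])
    from invertible_if_near_e[OF this] t'(2) obtain v where v: "v \<in> B" "(e - y) * v = e"
      by (auto simp: y_def)
    have "(e - p) * (e + t') = e - y"
      by (simp add: y_def distrib_left right_id)
    then have "(e - p) * ((e + t') * v) = e" using v(2) by (simp add: mult.assoc[symmetric])
    moreover have "(e + t') * v \<in> B"
      using t'(1) T_B by (intro mult_in_B subspace_add[OF subspace_B e_in_B]) auto
    ultimately show False using c'(2) B_commute[OF epB] unfolding p_def by metis
  qed
  have pp: "p * p = p" by (rule p_left[OF pT])
  \<comment> \<open>\<open>a * t'\<close> is \<open>p - y\<close> with \<open>y\<close> small,
    inverted by \<open>p + s\<close>; the quasi-inverse \<open>s\<close> stays in \<open>T\<close>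
    because \<open>s = y + y * s\<close>.\<close>
  have field: "\<exists>b\<in>T. a * b = p" if "a \<in> T" "a \<noteq> 0" for a
  proof -
    have "a * p \<noteq> 0" using that p_left[of a] T_commute[OF that(1) pT] by simp
    from dense[OF _ pT this pT] that T_B obtain t' where t': "t' \<in> T" "norm (p - a * t') < 1" by blast
    define y where "y = p - a * t'"
    have yT: "y \<in> T" unfolding y_def by (intro T_diff pT T_mult_right that)
    obtain s where s: "s = y + y * s" using quasi_inverse_exists[of y] t'(2) by (auto simp: y_def)
    have sT: "s \<in> T" using T_add[OF yT T_mult_right[OF yT, of s]] s by simp
    have "a * (t' * (p + s)) = (p - y) * (p + s)" by (simp add: y_def mult.assoc)
    also have "\<dots> = p + s - (y + y * s)"
      using p_left[OF sT] p_left[OF yT] T_commute[OF yT pT] pp by (simp add: algebra_simps)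
    also have "\<dots> = p" using s by simp
    finally show ?thesis using T_mult_right[OF t'(1)] by blast
  qed
  have complex_multiples: "\<exists>z. t = cscale z * p" if "t \<in> T" for t
  proof (rule Gelfand_Mazur_subalgebra[of T p "\<lambda>z. cscale z * p" "(norm e + norm i) * norm p" t])
    show "cscale z * p \<in> T" for z by (rule T_mult[OF cscale_in_B pT])
    show "cscale (z + w) * p = cscale z * p + cscale w * p" for z w
      by (simp add: cscale_add distrib_right)
    show "cscale (z * w) * p = cscale z * p * (cscale w * p)" for z w
      using p_left[OF T_mult[OF cscale_in_B pT]] by (simp add: cscale_mult mult.assoc)
    show "cscale 1 * p = p" by (simp add: cscale_1 B_D[OF pB])
    show "norm (cscale z * p) \<le> (norm e + norm i) * norm p * cmod z" for z
      using order_trans[OF norm_mult_ineq mult_right_mono[OF norm_cscale]] by (simp add: mult_ac)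
  qed (use T_diff T_mult_right T_commute pT p_left field that in auto)
  have "D p = 0" by (rule D_idempotent[OF pB pp])
  have "D (cscale z) = 0" for z
    by (simp add: cscale_def linear_add[OF linD] linear_scale[OF linD] D_e D_i)
  then have D_T: "D t = 0" if "t \<in> T" for t
    using complex_multiples[OF that] \<open>D p = 0\<close> by (auto simp: D_mult[OF cscale_in_B])
  \<comment> \<open>As \<open>p * y n\<close> lies in \<open>T\<close>, the product rule gives
    \<open>p * D (y n) = 0\<close>. In the limit \<open>p\<close> kills \<open>s0\<close>, yet it
    fixes \<open>c * s0\<close>.\<close>
  obtain y where y: "y \<longlonglongrightarrow> 0" "(\<lambda>n. D (y n)) \<longlonglongrightarrow> s0" using s0(1) by (rule separating_spaceE)
  have "p * D (y n) = 0" for n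
    using D_T[OF T_mult_right[OF pT, of "y n"]] by (simp add: D_mult[OF pB] \<open>D p = 0\<close>)
  moreover have "(\<lambda>n. p * D (y n)) \<longlonglongrightarrow> p * s0" by (intro tendsto_intros y)
  ultimately have "p * s0 = 0" by (simp add: LIMSEQ_const_iff)
  then have "p * t0 = 0" by (simp add: t0_def B_left_commute[OF pB cB])
  then show False using p_left[OF t0(1)] t0(2) by simp
qed

lemma derivation_trivial: "D y = 0"
proof (rule ccontr)
  assume "D y \<noteq> 0"
  obtain C where C: "\<And>y. \<exists>s\<in>S. norm (D y - s) \<le> C * norm y"
    using linear_bounded_modulo_separating_space[OF linD] by blast
  have bound: "norm (D y) \<le> \<bar>C\<bar> * norm y" for y
    using C[of y] mult_right_mono[OF abs_ge_self[of C] norm_ge_zero[of y]]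
    by (auto simp: separating_space_trivial)
  \<comment> \<open>The argument is moved into \<open>B\<close>, where the quasi-invertibility lemma
    takes it.\<close>
  have "D (e * y) \<noteq> 0" using \<open>D y \<noteq> 0\<close> by (simp add: D_e_mult)
  from semisimple[OF D_in_B this] bounded_derivation_quasi_invertible[OF e_mult_in_B[of y] bound]
  show False by auto
qed

end

section \<open>Generalized derivations\<close>

text \<open>The element \<open>r = c b - e c b\<close> is annihilated from the left, so
  \<open>1 - c b = (1 - e c b) (1 - r)\<close> in the unitization.\<close>

lemma left_quasi_invertible_if_corner_invertible:
  fixes b c e v :: "'a::ring"
  assumes right_id: "\<And>a. a * e = a" and v: "v * (e - e * c * b) = e"
  shows "left_quasi_invertible (c * b)"
proof -
  have e_left: "x * (e * y) = x * y" for x y by (metis mult.assoc right_id)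
  define g r x where "g = e * c * b" and "r = c * b - g" and "x = e - v"
  have xr: "y * r = 0" for y
    by (simp add: r_def g_def right_diff_distrib mult.assoc e_left)
  have cb: "c * b = g + r" by (simp add: r_def)
  have "v - v * g = e" using v by (simp add: g_def right_diff_distrib right_id)
  moreover have "e * g = g" by (simp add: g_def mult.assoc e_left right_id)
  ultimately have 0: "x + g - x * g = 0"
    by (simp add: x_def left_diff_distrib) (simp add: algebra_simps)
  \<comment> \<open>The witness \<open>w\<close> is read off from 1 - w = (1 + r) (1 - x) in the
    unitization: 1 - x inverts 1 - g, and 1 + r inverts 1 - r because
    \<open>r * r = 0\<close>.\<close>
  have "(x - r + r * x) + c * b - (x - r + r * x) * (c * b) = (x + g - x * g) + r * (x + g - x * g)"
    unfolding cb by (simp add: algebra_simps xr)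
  also have "\<dots> = 0" by (simp add: 0)
  finally show ?thesis unfolding left_quasi_invertible_def by blast
qed

lemma derivation_into_rann:
  fixes J d :: "'a::{real_normed_algebra, banach} \<Rightarrow> 'a"
  assumes J: "complex_structure J"
    and rad: "(jrad :: 'a set) = rann"
    and left_mult_commute: "\<And>x a b :: 'a. x * (a * b) = x * (b * a)"
    and right_id: "\<And>a :: 'a. a * e = a"
    and d: "is_derivation J d"
  shows "x * d y = 0"
proof -
  have lin: "linear d" and d_mult: "\<And>a b. d (a * b) = d a * b + a * d b"
    using d by (auto simp: is_derivation_def clinear_def)
  have J_J: "J (J x) = - x" and J_left: "J (x * y) = J x * y" and J_right: "J (x * y) = x * J y" for x y
    using J unfolding complex_structure_def by blast+
  interpret comm_right_unital e
    using right_id left_mult_commute by unfold_locales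
  interpret semisimple_derivation e "\<lambda>y. e * d y" "J e"
  proof (intro semisimple_derivation.intro right_unital_derivation.intro
      right_unital_derivation_axioms.intro semisimple_derivation_axioms.intro comm_right_unital_axioms)
    show "linear (\<lambda>y. e * d y)"
      by (intro linearI) (auto simp: linear_add[OF lin] linear_scale[OF lin] distrib_left)
    show "e * (e * d y) = e * d y" for y by (rule mult_e_left)
    show "e * d (b * y) = e * d b * y + b * (e * d y)" if "b \<in> B" for b y
      using B_D[OF that] by (simp add: d_mult distrib_left mult_e_left) (metis mult.assoc)
    show "J e \<in> B" by (simp add: B_def J_right[symmetric] right_id)
    show "J e * J e = - e" by (simp add: J_left[symmetric] J_right[symmetric] right_id J_J)
  next
    fix b assume b: "b \<in> B" "b \<noteq> 0"
    \<comment> \<open>Otherwise \<open>b\<close> would lie in \<open>jrad\<close>, hence in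
      \<open>rann\<close>, and \<open>b = e * b\<close> would be 0.\<close>
    show "\<exists>c\<in>B. \<not> (\<exists>v\<in>B. v * (e - c * b) = e)"
    proof (rule ccontr)
      assume "\<not> ?thesis"
      then have "\<exists>v. v * (e - e * c * b) = e" for c using e_mult_in_B by blast
      then have "b \<in> jrad"
        unfolding jrad_def using left_quasi_invertible_if_corner_invertible[OF right_id] by blast
      then have "e * b = 0" by (simp add: rad rann_def)
      then show False using b B_D by simp
    qed
  qed
  show ?thesis using derivation_trivial[of y] mult_e_left[of x "d y"] by simp
qed

theorem theorem4p10:
  fixes J \<delta> d :: "'a::{real_normed_algebra, banach} \<Rightarrow> 'a"
  assumes "complex_structure J"
    and "(jrad :: 'a set) = rann"
    and "\<forall>x y :: 'a. comm x y \<in> jrad"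
    and "\<exists>e :: 'a. \<forall>a. a * e = a"
    and "is_gen_derivation J \<delta> d"
  shows "((\<forall>a. comm (comm (\<delta> a) a) (\<delta> a) \<in> center) \<longleftrightarrow> orthogonal_maps d \<delta>)
       \<and> (orthogonal_maps d \<delta> \<longleftrightarrow> is_gen_derivation J (\<delta> \<circ> \<delta>) (d \<circ> d))"
proof -
  obtain e :: 'a where right_id: "\<And>a. a * e = a" using assms(4) by blast
  have left_mult_commute: "x * (a * b) = x * (b * a)" for x a b :: 'a
  proof -
    have "comm a b \<in> rann" using assms(2,3) by blast
    then show ?thesis by (simp add: rann_def comm_def right_diff_distrib)
  qed
  have d: "is_derivation J d" and lin_\<delta>: "linear \<delta>" and J_\<delta>: "\<And>x. \<delta> (J x) = J (\<delta> x)"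
    and \<delta>_mult: "\<And>a b. \<delta> (a * b) = a * \<delta> b + d a * b"
    using assms(5) by (auto simp: is_gen_derivation_def clinear_def)
  then have lin_d: "linear d" and J_d: "\<And>x. d (J x) = J (d x)"
    and d_mult: "\<And>a b. d (a * b) = d a * b + a * d b"
    by (auto simp: is_derivation_def clinear_def)
  have d_rann: "x * d y = 0" for x y
    by (rule derivation_into_rann[OF assms(1,2) left_mult_commute right_id d])
  then have d_rann2: "x * (d y * z) = 0" for x y z
    by (metis mult.assoc mult_zero_left)
  have e_left: "x * (e * y) = x * y" for x y by (metis mult.assoc right_id)
  define f where "f = \<delta> e"
  have \<delta>_eq: "\<delta> a = a * f + d a" for a
    using \<delta>_mult[of a e] by (simp add: right_id f_def)
  define E where "E \<longleftrightarrow> (\<forall>a. d a * f = 0)"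
  have E_mult: "d a * (x * f) = 0" if E for a x
    using that left_mult_commute[of "d a" x f] unfolding E_def by (metis mult.assoc mult_zero_left)

  have orth: "orthogonal_maps d \<delta> \<longleftrightarrow> E"
  proof
    assume "orthogonal_maps d \<delta>"
    then have "d a * e * \<delta> e = 0" for a by (auto simp: orthogonal_maps_def)
    then show E unfolding E_def f_def by (simp add: right_id)
  next
    assume E
    then show "orthogonal_maps d \<delta>"
      using E_mult[of _ "_ * _"]
      by (simp add: orthogonal_maps_def \<delta>_eq distrib_left d_rann mult.assoc)
  qed

  have double_comm: "comm (comm (\<delta> a) a) (\<delta> a) = d a * (a * (a * f))" for a
  proof -
    have "comm (\<delta> a) a = d a * a"
      using left_mult_commute[of a f a]
      by (simp add: comm_def \<delta>_eq distrib_left distrib_right d_rann mult.assoc)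
    then show ?thesis
      by (simp add: comm_def \<delta>_eq distrib_left distrib_right d_rann d_rann2 mult.assoc)
  qed
  have central: "(\<forall>a. comm (comm (\<delta> a) a) (\<delta> a) \<in> center) \<longleftrightarrow> E"
  proof
    assume i: "\<forall>a. comm (comm (\<delta> a) a) (\<delta> a) \<in> center"
    \<comment> \<open>Centrality is tested against \<open>e\<close>: on the right \<open>e\<close>
      fixes the element, on the left it meets a value of \<open>d\<close> and gives 0.\<close>
    have P: "d a * (a * (a * f)) = 0" for a
    proof -
      have "d a * (a * (a * f)) * e = e * (d a * (a * (a * f)))"
        using i unfolding double_comm center_def by blast
      then show ?thesis by (simp add: right_id d_rann2)
    qed
    have "d e * f = 0" using P[of e] by (simp add: e_left)
    then have de: "d e * (x * f) = 0" for x
      using left_mult_commute[of "d e" x f] by (metis mult.assoc mult_zero_left)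
    have de2: "d e * (a * (a * f)) = 0" for a
      using de[of "a * a"] by (simp add: mult.assoc)
    have "d a * f = 0" for a
    proof -
      \<comment> \<open>Polarization: the terms linear in the shift change sign between
        \<open>a + e\<close> and \<open>a - e\<close>, so adding the two identities isolates
        \<open>d a * f\<close>.\<close>
      have 1: "d a * (a * f) + d a * (a * f) + d a * f = 0"
        using P[of "a + e"] P[of a] \<open>d e * f = 0\<close> de[of a] de2[of a]
        by (simp add: linear_add[OF lin_d] distrib_left distrib_right e_left add_ac)
      have 2: "- (d a * (a * f)) - d a * (a * f) + d a * f = 0"
        using P[of "a - e"] P[of a] \<open>d e * f = 0\<close> de[of a] de2[of a]
        by (simp add: linear_diff[OF lin_d] left_diff_distrib right_diff_distrib e_left)
      have "2 *\<^sub>R (d a * f) = 0" using arg_cong2[OF 1 2, of "(+)"] by (simp add: scaleR_2)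
      then show ?thesis by simp
    qed
    then show E by (simp add: E_def)
  next
    assume E
    then have "d a * (a * (a * f)) = 0" for a
      using E_mult[of a "a * a"] by (simp add: mult.assoc)
    then show "\<forall>a. comm (comm (\<delta> a) a) (\<delta> a) \<in> center"
      by (simp add: double_comm center_def)
  qed

  \<comment> \<open>The usual cross terms \<open>d a * d b\<close> vanish because \<open>d\<close>
    takes values in the right annihilator.\<close>
  have deriv2: "is_derivation J (d \<circ> d)"
    using linear_compose[OF lin_d lin_d] J_d
    by (auto simp: is_derivation_def clinear_def d_mult d_rann linear_add[OF lin_d])
  \<comment> \<open>Both \<open>a * \<delta> b\<close> and \<open>d a * b\<close> contribute a copy
    of \<open>d a * \<delta> b\<close>, which equals \<open>d a * (b * f)\<close>.\<close>
  have \<delta>2: "\<delta> (\<delta> (a * b)) = a * \<delta> (\<delta> b) + d (d a) * b + 2 *\<^sub>R (d a * (b * f))" for a b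
    by (simp add: \<delta>_mult linear_add[OF lin_\<delta>] scaleR_2)
       (simp add: \<delta>_eq[of b] distrib_left d_rann)
  have gen2: "is_gen_derivation J (\<delta> \<circ> \<delta>) (d \<circ> d) \<longleftrightarrow> E"
  proof
    assume "is_gen_derivation J (\<delta> \<circ> \<delta>) (d \<circ> d)"
    then have "\<delta> (\<delta> (a * e)) = a * \<delta> (\<delta> e) + d (d a) * e" for a
      by (simp add: is_gen_derivation_def)
    then have "d a * (e * f) = 0" for a using \<delta>2[of a e] by simp
    then show E by (simp add: E_def e_left)
  next
    assume E
    then have "\<delta> (\<delta> (a * b)) = a * \<delta> (\<delta> b) + d (d a) * b" for a b
      using \<delta>2[of a b] E_mult by simp
    then show "is_gen_derivation J (\<delta> \<circ> \<delta>) (d \<circ> d)"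
      using deriv2 linear_compose[OF lin_\<delta> lin_\<delta>] J_\<delta>
      by (auto simp: is_gen_derivation_def clinear_def)
  qed
  show ?thesis using orth central gen2 by simp
qed

end
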